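(* For all integers $n \geq 3$, $$q \cdot r_n = r_{n-2}\,\omega_n,$$ where $r_m$ (for $m\ge 2$) is the number of chambers in $\Xi_m$ containing a given vertex of $\Xi_m$, $r_1 = 1$, and $\omega_n$ is the number of vertices in $\Xi_n$ close to a given vertex of $\Xi_n$.
   Context: $K$ is a (nonarchimedean) local field with discrete valuation $\mathrm{ord}$, valuation ring $\mathcal{O}$, uniformizer $\pi$ and residue field $k \cong \mathbb{F}_q$. A lattice in a finite-dimensional $K$-vector space $V$ is a free $\mathcal{O}$-submodule of $V$ of rank $\dim_K V$; lattices $L, L'$ in $V$ are homothetic if $L' = \alpha L$ for some $\alpha \in K^\times$, and $[L]$ denotes the homothety class of $L$. For an integer $m\ge 2$, the affine building $\Xi_m$ of $\mathrm{SL}_m(K)$ is the following simplicial complex of dimension $m-1$. Fix an $m$-dimensional $K$-vector space $V$. Vertices are homothety classes of lattices in $V$. Vertices $t,t'$ are incident if there are $L \in t$, $L' \in t'$ with $\pi L \subseteq L' \subseteq L$. Simplices are the finite sets of pairwise incident vertices. A chamber is a maximal simplex; it has $m$ vertices $t_0,\dots,t_{m-1}$ with representatives $L_i \in t_i$ such that $\pi L_0 \subsetneq L_1 \subsetneq \cdots \subsetneq L_{m-1} \subsetneq L_0$ and $[L_1:\pi L_0] = q = [L_i : L_{i-1}]$ for $2 \le i \le m-1$. Two chambers are adjacent if they share a codimension-one face. Two vertices $t,t'$ are close if there are adjacent chambers $C, C'$ with $t \in C$, $t' \in C'$, but $t,t' \notin C \cap C'$. The numbers $r_m$ and $\omega_n$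 do not depend on the chosen vertex. *)

theory Defs
  imports Complex_Main
begin

text \<open>
  A nonarchimedean local field: a field, complete with respect to a normalised discrete valuation,
  with finite residue field.  The valuation is a map from the nonzero elements to the integers;
  the value of \<open>ord\<close> at \<open>0\<close> is unconstrained and never used, so \<open>0\<close> (valuation infinity) is treated
  separately everywhere.
\<close>

locale local_field =
  fixes ord :: "'k::field \<Rightarrow> int"
    and \<pi> :: 'k
  assumes ord_mult: "x \<noteq> 0 \<Longrightarrow> y \<noteq> 0 \<Longrightarrow> ord (x * y) = ord x + ord y"
    and ord_add: "x \<noteq> 0 \<Longrightarrow> y \<noteq> 0 \<Longrightarrow> x + y \<noteq> 0 \<Longrightarrow> min (ord x) (ord y) \<le> ord (x + y)"
    and uniformizer: "\<pi> \<noteq> 0" "ord \<pi> = 1"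
    and complete: "\<And>X :: nat \<Rightarrow> 'k.
      (\<forall>N. \<exists>M. \<forall>i\<ge>M. \<forall>j\<ge>M. X i = X j \<or> N \<le> ord (X i - X j)) \<Longrightarrow>
      (\<exists>l. \<forall>N. \<exists>M. \<forall>i\<ge>M. X i = l \<or> N \<le> ord (X i - l))"
    and finite_residue_field:
      "finite ({x. x = 0 \<or> 0 \<le> ord x} //
        {(x, y). (x = 0 \<or> 0 \<le> ord x) \<and> (y = 0 \<or> 0 \<le> ord y) \<and> (x = y \<or> 0 < ord (x - y))})"
begin

definition \<O> :: "'k set" where
  "\<O> = {x. x = 0 \<or> 0 \<le> ord x}"

definition residue_field :: "'k set set" where
  "residue_field = \<O> // {(x, y). x \<in> \<O> \<and> y \<in> \<O> \<and> (x = y \<or> 0 < ord (x - y))}"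

definition q :: nat where
  "q = card residue_field"

end

text \<open>
  The \<open>m\<close>-dimensional space is a subspace \<open>V\<close> of an arbitrary ambient vector space, so that \<open>m\<close> is
  not tied to a type.  The case \<open>m = 1\<close> is admitted only to accommodate the convention \<open>r\<^sub>1 = 1\<close>.
  As \<open>dim\<close> is \<open>0\<close> on infinite-dimensional spaces, \<open>0 < m\<close> makes \<open>V\<close> finite-dimensional.
\<close>

locale building = local_field ord \<pi> + vector_space scale
  for ord :: "'k::field \<Rightarrow> int"
    and \<pi> :: 'k
    and scale :: "'k \<Rightarrow> 'v::ab_group_add \<Rightarrow> 'v" (infixr \<open>*s\<close> 75) +
  fixes V :: "'v set"
    and m :: nat
  assumes subspace_V: "subspace V"
    and dim_V: "dim V = m"
    and m_pos: "0 < m"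
begin

definition submodule :: "'v set \<Rightarrow> bool" where
  "submodule L \<longleftrightarrow> L \<subseteq> V \<and> 0 \<in> L \<and> (\<forall>x\<in>L. \<forall>y\<in>L. x + y \<in> L) \<and> (\<forall>a\<in>\<O>. \<forall>x\<in>L. a *s x \<in> L)"

definition free_basis :: "'v set \<Rightarrow> 'v set \<Rightarrow> bool" where
  "free_basis B L \<longleftrightarrow> finite B \<and> B \<subseteq> L \<and>
    (\<forall>x\<in>L. \<exists>c. (\<forall>b\<in>B. c b \<in> \<O>) \<and> x = (\<Sum>b\<in>B. c b *s b)) \<and>
    (\<forall>c. (\<forall>b\<in>B. c b \<in> \<O>) \<and> (\<Sum>b\<in>B. c b *s b) = 0 \<longrightarrow> (\<forall>b\<in>B. c b = 0))"

definition is_lattice :: "'v set \<Rightarrow> bool" where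
  "is_lattice L \<longleftrightarrow> submodule L \<and> (\<exists>B. free_basis B L \<and> card B = m)"

definition homothetic :: "('v set \<times> 'v set) set" where
  "homothetic = {(L, L'). is_lattice L \<and> is_lattice L' \<and> (\<exists>\<alpha>. \<alpha> \<noteq> 0 \<and> L' = (\<lambda>x. \<alpha> *s x) ` L)}"

definition vertices :: "'v set set set" where
  "vertices = {L. is_lattice L} // homothetic"

definition incident :: "'v set set \<Rightarrow> 'v set set \<Rightarrow> bool" where
  "incident t t' \<longleftrightarrow> (\<exists>L\<in>t. \<exists>L'\<in>t'. (\<lambda>x. \<pi> *s x) ` L \<subseteq> L' \<and> L' \<subseteq> L)"

definition simplex :: "'v set set set \<Rightarrow> bool" where
  "simplex S \<longleftrightarrow> finite S \<and> S \<subseteq> vertices \<and> pairwise incident S"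

definition chamber :: "'v set set set \<Rightarrow> bool" where
  "chamber C \<longleftrightarrow> simplex C \<and> (\<forall>S. simplex S \<and> C \<subseteq> S \<longrightarrow> S = C)"

text \<open>
  A face of a chamber is a subset of it, of codimension one if it omits exactly one vertex.
  With this reading a chamber is adjacent to itself, which is irrelevant for \<open>close\<close> below.
\<close>

definition adjacent :: "'v set set set \<Rightarrow> 'v set set set \<Rightarrow> bool" where
  "adjacent C C' \<longleftrightarrow> chamber C \<and> chamber C' \<and>
    (\<exists>F. F \<subseteq> C \<and> F \<subseteq> C' \<and> card C = card F + 1 \<and> card C' = card F + 1)"

definition close :: "'v set set \<Rightarrow> 'v set set \<Rightarrow> bool" where
  "close t t' \<longleftrightarrow> (\<exists>C C'. adjacent C C' \<and> t \<in> C \<and> t' \<in> C' \<and> t \<notin> C \<inter> C' \<and> t' \<notin> C \<inter> C')"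

definition r :: "'v set set \<Rightarrow> nat" where
  "r t = (if m = 1 then 1 else card {C. chamber C \<and> t \<in> C})"

definition \<omega> :: "'v set set \<Rightarrow> nat" where
  "\<omega> t = card {t'. close t t'}"

end

end

theory Submission
  imports Defs "HOL-Library.FuncSet"
begin

text \<open>
  Fix a vertex \<open>[L]\<close>.  Every vertex incident to it has exactly one representative \<open>M\<close> with
  \<open>\<pi> L \<subset> M \<subseteq> L\<close>, and two such vertices are incident iff their representatives are comparable
  (\<open>normalized_representative\<close>, \<open>inj_on_cls\<close>, \<open>incident_interval_iff\<close>).  So the chambers containing
  \<open>[L]\<close> correspond to the maximal chains of submodules strictly above \<open>\<pi> L\<close> and contained in \<open>L\<close>
  (\<open>chambers_through\<close>), that is, to the complete flags of the \<open>m\<close>-dimensional residue space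
  \<open>L / \<pi> L\<close>.  The number of complete flags depends on the dimension and on \<open>q\<close> only
  (\<open>card_flags\<close>), which makes the numbers \<open>r\<close> of two buildings over the same field comparable.

  Call \<open>(P, H)\<close> a gate of \<open>L\<close> if \<open>\<pi> L \<subset> P \<subseteq> H \<subset> L\<close>, where \<open>P\<close> covers \<open>\<pi> L\<close> and \<open>L\<close> covers \<open>H\<close>: a line
  in a hyperplane of \<open>L / \<pi> L\<close>.  A complete flag determines the gate formed by its first and its
  last proper member, and what lies between them is a complete flag of the space \<open>H / P\<close>, which
  has dimension \<open>m - 2\<close>.  Hence
  the number \<open>r\<close> for \<open>m\<close> is the number of gates times the number \<open>r\<close> for \<open>m - 2\<close>
  (\<open>flag_number_eq_gates\<close>).

  A vertex close to \<open>[L]\<close> arises by taking a chamber through \<open>[L]\<close>, with gate \<open>(P, H)\<close>, and replacing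
  \<open>[L]\<close> by another vertex.  Seen from the vertex \<open>[H]\<close>, the vertex \<open>[L]\<close> is represented by \<open>\<pi> L\<close>, and it
  fills the gap between \<open>\<pi> H\<close> and \<open>P\<close>, of index \<open>q\<^sup>2\<close>.  The modules strictly between \<open>\<pi> H\<close> and \<open>P\<close>
  correspond to the \<open>q + 1\<close> lines of a plane over the residue field, and any of them other than
  \<open>\<pi> L\<close> completes the remaining members to a chamber: these are the \<open>q\<close> exchanges at the gate.  The
  new vertex determines the gate (\<open>exchange_inj\<close>), so
  \<open>\<omega>\<close> is \<open>q\<close> times the number of gates (\<open>card_close\<close>).  Eliminating the number of gates proves the claim.
\<close>

section \<open>The valuation ring\<close>

context local_field
begin

lemma ord_one: "ord 1 = 0"
  using ord_mult[of 1 1] by simp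

lemma ord_minus_one: "ord (- 1) = 0"
  using ord_mult[of "-1" "-1"] ord_one by simp

lemma ord_inverse: "x \<noteq> 0 \<Longrightarrow> ord (inverse x) = - ord x"
  using ord_mult[of x "inverse x"] ord_one by simp

lemma integers_zero [simp]: "0 \<in> \<O>"
  by (simp add: \<O>_def)

lemma integers_one [simp]: "1 \<in> \<O>"
  by (simp add: \<O>_def ord_one)

lemma integers_uniformizer [simp]: "\<pi> \<in> \<O>"
  by (simp add: \<O>_def uniformizer)

lemma integers_mult: "x \<in> \<O> \<Longrightarrow> y \<in> \<O> \<Longrightarrow> x * y \<in> \<O>"
  using ord_mult[of x y] by (cases "x = 0 \<or> y = 0") (auto simp: \<O>_def)

lemma integers_add:
  assumes "x \<in> \<O>" "y \<in> \<O>" shows "x + y \<in> \<O>"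
  using ord_add[of x y] assms by (cases "x = 0 \<or> y = 0 \<or> x + y = 0") (auto simp: \<O>_def)

lemma integers_uminus: "x \<in> \<O> \<Longrightarrow> - x \<in> \<O>"
  using integers_mult[of "-1" x] ord_minus_one by (simp add: \<O>_def)

lemma integers_diff: "x \<in> \<O> \<Longrightarrow> y \<in> \<O> \<Longrightarrow> x - y \<in> \<O>"
  using integers_add[of x "-y"] integers_uminus[of y] by simp

lemma divide_uniformizer_integral_iff:
  assumes "x \<noteq> 0" shows "x / \<pi> \<in> \<O> \<longleftrightarrow> 1 \<le> ord x"
proof -
  have "ord (x / \<pi>) = ord x - 1"
    using assms ord_mult[of x "inverse \<pi>"] ord_inverse[of \<pi>] uniformizer
    by (simp add: divide_inverse)
  then show ?thesis using assms uniformizer by (auto simp: \<O>_def)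
qed

text \<open>
  Membership of \<open>x / \<pi>\<close> in \<open>\<O>\<close> expresses that \<open>x\<close> lies in the maximal ideal, so this separates the
  maximal ideal from the units.
\<close>

lemma divide_uniformizer_cases:
  assumes "x \<in> \<O>"
  obtains "x / \<pi> \<in> \<O>" | "x \<noteq> 0" "ord x = 0" "inverse x \<in> \<O>"
  using assms divide_uniformizer_integral_iff[of x] ord_inverse[of x]
  by (cases "x = 0"; cases "ord x = 0") (auto simp: \<O>_def)

text \<open>
  A system of representatives of the residue field inside \<open>\<O>\<close> allows counting residue classes
  without computing in the quotient set.  Congruence is written \<open>(x - u) / \<pi> \<in> \<O>\<close>, which is uniform
  in the case \<open>x = u\<close>, where the valuation says nothing.
\<close>

lemma residue_representatives:
  obtains T where "finite T" "card T = q" "T \<subseteq> \<O>"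
    "\<And>x. x \<in> \<O> \<Longrightarrow> \<exists>u\<in>T. (x - u) / \<pi> \<in> \<O>"
    "\<And>u v. u \<in> T \<Longrightarrow> v \<in> T \<Longrightarrow> (u - v) / \<pi> \<in> \<O> \<Longrightarrow> u = v"
proof -
  define R where "R = {(x, y). x \<in> \<O> \<and> y \<in> \<O> \<and> (x - y) / \<pi> \<in> \<O>}"
  have R_alt: "R = {(x, y). x \<in> \<O> \<and> y \<in> \<O> \<and> (x = y \<or> 0 < ord (x - y))}"
  proof -
    have "(x - y) / \<pi> \<in> \<O> \<longleftrightarrow> x = y \<or> 0 < ord (x - y)" for x y
      using divide_uniformizer_integral_iff[of "x - y"] by (cases "x = y") auto
    then show ?thesis by (simp add: R_def)
  qed
  have eq: "equiv \<O> R"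
  proof (rule equivI)
    show "R \<subseteq> \<O> \<times> \<O>" by (auto simp: R_def)
    show "refl_on \<O> R" by (auto simp: R_def refl_on_def)
    show "sym R"
    proof (rule symI)
      fix x y assume "(x, y) \<in> R"
      then show "(y, x) \<in> R"
        using integers_uminus[of "(x - y) / \<pi>"] by (simp add: R_def minus_divide_left)
    qed
    show "trans R"
    proof (rule transI)
      fix x y z assume "(x, y) \<in> R" "(y, z) \<in> R"
      then show "(x, z) \<in> R"
        using integers_add[of "(x - y) / \<pi>" "(y - z) / \<pi>"]
        by (simp add: R_def flip: add_divide_distrib)
    qed
  qed
  have res: "residue_field = \<O> // R"
    by (simp add: residue_field_def R_alt)
  have fin: "finite residue_field"
    using finite_residue_field by (simp add: residue_field_def \<O>_def)
  define rep where "rep X = (SOME x. x \<in> X)" for X :: "'k set"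
  have rep: "rep X \<in> X" if "X \<in> residue_field" for X
    using that in_quotient_imp_non_empty[OF eq, of X] unfolding res rep_def
    by (simp add: some_in_eq)
  have rep_O: "rep X \<in> \<O>" if "X \<in> residue_field" for X
    using rep[OF that] that in_quotient_imp_subset[OF eq, of X] res by auto
  have inj: "inj_on rep residue_field"
  proof (rule inj_onI)
    fix X Y assume XY: "X \<in> residue_field" "Y \<in> residue_field" "rep X = rep Y"
    then have "(rep X, rep Y) \<in> R" using rep_O by (simp add: R_def)
    then show "X = Y" using quotient_eqI[OF eq] rep XY res by metis
  qed
  show thesis
  proof (rule that[of "rep ` residue_field"])
    show "finite (rep ` residue_field)" using fin by simp
    show "card (rep ` residue_field) = q" using card_image[OF inj] by (simp add: q_def)
    show "rep ` residue_field \<subseteq> \<O>" using rep_O by auto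
  next
    fix x assume "x \<in> \<O>"
    then have X: "R `` {x} \<in> residue_field" by (simp add: res quotientI)
    then have "(x, rep (R `` {x})) \<in> R" using rep[OF X] by blast
    then show "\<exists>u\<in>rep ` residue_field. (x - u) / \<pi> \<in> \<O>" using X by (auto simp: R_def)
  next
    fix u v assume uv: "u \<in> rep ` residue_field" "v \<in> rep ` residue_field" "(u - v) / \<pi> \<in> \<O>"
    then obtain X Y where XY: "X \<in> residue_field" "Y \<in> residue_field" "u = rep X" "v = rep Y"
      by auto
    then have "(u, v) \<in> R" using uv rep_O by (auto simp: R_def)
    then have "X = Y" using quotient_eqI[OF eq] rep XY res by metis
    then show "u = v" using XY by simp
  qed
qed

text \<open>
  The representatives of \<open>0\<close> and \<open>1\<close> differ, since \<open>1 / \<pi>\<close> is not integral.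
\<close>

lemma one_less_q: "1 < q"
proof -
  obtain T where T: "finite T" "card T = q" "T \<subseteq> \<O>"
    "\<And>x. x \<in> \<O> \<Longrightarrow> \<exists>u\<in>T. (x - u) / \<pi> \<in> \<O>"
    using residue_representatives by metis
  obtain u v where uv: "u \<in> T" "(0 - u) / \<pi> \<in> \<O>" "v \<in> T" "(1 - v) / \<pi> \<in> \<O>"
    using T(4)[of 0] T(4)[of 1] by auto
  have "u \<noteq> v"
  proof
    assume "u = v"
    then have "1 / \<pi> \<in> \<O>"
      using integers_diff[OF uv(4,2)] unfolding diff_divide_distrib[symmetric] by simp
    then show False using divide_uniformizer_integral_iff[of 1] ord_one by simp
  qed
  then have "card {u, v} \<le> card T" by (intro card_mono) (use T uv in auto)
  then show ?thesis using T \<open>u \<noteq> v\<close> by simp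
qed

end

section \<open>Submodules and dilations\<close>

context building
begin

abbreviation dilate :: "'k \<Rightarrow> 'v set \<Rightarrow> 'v set" where
  "dilate \<alpha> L \<equiv> (\<lambda>x. \<alpha> *s x) ` L"

lemma submoduleD:
  assumes "submodule L"
  shows "L \<subseteq> V" "0 \<in> L" "\<And>x y. x \<in> L \<Longrightarrow> y \<in> L \<Longrightarrow> x + y \<in> L"
    "\<And>a x. a \<in> \<O> \<Longrightarrow> x \<in> L \<Longrightarrow> a *s x \<in> L"
  using assms by (auto simp: submodule_def)

lemma submodule_uminus: "submodule L \<Longrightarrow> x \<in> L \<Longrightarrow> - x \<in> L"
  using submoduleD(4)[of L "-1" x] integers_uminus[OF integers_one] by simp

lemma submodule_diff: "submodule L \<Longrightarrow> x \<in> L \<Longrightarrow> y \<in> L \<Longrightarrow> x - y \<in> L"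
  using submoduleD(3)[of L x "-y"] submodule_uminus[of L y] by simp

lemma submodule_sum:
  assumes "submodule L" "\<And>i. i \<in> I \<Longrightarrow> f i \<in> L" shows "sum f I \<in> L"
  using assms(2) by (induction I rule: infinite_finite_induct) (auto simp: submoduleD[OF assms(1)])

lemma submodule_Int: "submodule L \<Longrightarrow> submodule L' \<Longrightarrow> submodule (L \<inter> L')"
  by (auto simp: submodule_def)

lemma dilate_dilate: "dilate \<alpha> (dilate \<beta> L) = dilate (\<alpha> * \<beta>) L"
  by (simp add: image_image)

lemma dilate_one [simp]: "dilate 1 L = L"
  by simp

lemma dilate_subset_iff: "\<alpha> \<noteq> 0 \<Longrightarrow> dilate \<alpha> L \<subseteq> dilate \<alpha> L' \<longleftrightarrow> L \<subseteq> L'"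
  by (rule inj_image_subset_iff) (rule injective_scale)

lemma dilate_eq_iff: "\<alpha> \<noteq> 0 \<Longrightarrow> dilate \<alpha> L = dilate \<alpha> L' \<longleftrightarrow> L = L'"
  by (rule inj_image_eq_iff) (rule injective_scale)

lemma dilate_psubset_iff: "\<alpha> \<noteq> 0 \<Longrightarrow> dilate \<alpha> L \<subset> dilate \<alpha> L' \<longleftrightarrow> L \<subset> L'"
  by (simp add: psubset_eq dilate_subset_iff dilate_eq_iff)

lemma submodule_dilate:
  assumes "submodule L" shows "submodule (dilate \<alpha> L)"
  unfolding submodule_def
proof (intro conjI ballI)
  note L = submoduleD[OF assms]
  show "dilate \<alpha> L \<subseteq> V" using L(1) subspace_scale[OF subspace_V] by auto
  show "0 \<in> dilate \<alpha> L" using L(2) by (force simp: image_iff)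
  show "x + y \<in> dilate \<alpha> L" if "x \<in> dilate \<alpha> L" "y \<in> dilate \<alpha> L" for x y
    using that L(3) by (auto simp flip: scale_right_distrib)
  show "a *s x \<in> dilate \<alpha> L" if "a \<in> \<O>" "x \<in> dilate \<alpha> L" for a x
  proof -
    from that obtain y where y: "x = \<alpha> *s y" "y \<in> L" by auto
    then have "a *s x = \<alpha> *s (a *s y)" by (simp add: mult.commute)
    then show ?thesis using L(4)[OF that(1) y(2)] by blast
  qed
qed

lemma dilate_integral_subset: "submodule L \<Longrightarrow> \<alpha> \<in> \<O> \<Longrightarrow> dilate \<alpha> L \<subseteq> L"
  using submoduleD(4) by auto

text \<open>
  The three cases are those of positive, zero and negative valuation of \<open>\<alpha>\<close>; in the second case
  \<open>\<alpha>\<close> is a unit.  In the third case \<open>L\<close> is the dilation of \<open>\<alpha> L \<subseteq> N\<close> by a multiple of \<open>\<pi>\<close>.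
\<close>

lemma dilate_trichotomy:
  assumes "submodule L" "\<alpha> \<noteq> 0"
  obtains "dilate \<alpha> L \<subseteq> dilate \<pi> L" | "dilate \<alpha> L = L"
    | "\<And>N. dilate \<alpha> L \<subseteq> N \<Longrightarrow> submodule N \<Longrightarrow> L \<subseteq> dilate \<pi> N"
proof -
  have *: "dilate \<beta> N \<subseteq> dilate \<pi> N" if "submodule N" "\<beta> \<noteq> 0" "1 \<le> ord \<beta>" for \<beta> N
  proof -
    have "dilate (\<beta> / \<pi>) N \<subseteq> N"
      using that divide_uniformizer_integral_iff by (intro dilate_integral_subset) auto
    then have "dilate \<pi> (dilate (\<beta> / \<pi>) N) \<subseteq> dilate \<pi> N"
      using dilate_subset_iff uniformizer by blast
    then show ?thesis using uniformizer by (simp add: dilate_dilate)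
  qed
  have inv: "dilate (inverse \<alpha>) (dilate \<alpha> L) = L"
    using assms by (simp add: dilate_dilate)
  consider "1 \<le> ord \<alpha>" | "ord \<alpha> = 0" | "ord \<alpha> \<le> -1" by linarith
  then show thesis
  proof cases
    case 1
    then show ?thesis using * assms that(1) by blast
  next
    case 2
    then have "\<alpha> \<in> \<O>" "inverse \<alpha> \<in> \<O>"
      using ord_inverse[of \<alpha>] assms by (auto simp: \<O>_def)
    then have "dilate \<alpha> L \<subseteq> L" "dilate (inverse \<alpha>) L \<subseteq> L"
      using assms dilate_integral_subset by auto
    moreover have "L \<subseteq> dilate \<alpha> L"
      using \<open>dilate (inverse \<alpha>) L \<subseteq> L\<close> assms(2) dilate_subset_iff[OF assms(2), of "dilate (inverse \<alpha>) L" L]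
      by (simp add: dilate_dilate)
    ultimately show ?thesis using that(2) by blast
  next
    case 3
    show ?thesis
    proof (rule that(3))
      fix N assume N: "dilate \<alpha> L \<subseteq> N" "submodule N"
      then have "L \<subseteq> dilate (inverse \<alpha>) N"
        using inv dilate_subset_iff[of "inverse \<alpha>" "dilate \<alpha> L" N] assms by simp
      moreover have "dilate (inverse \<alpha>) N \<subseteq> dilate \<pi> N"
        using 3 assms ord_inverse[of \<alpha>] N by (intro *) auto
      ultimately show "L \<subseteq> dilate \<pi> N" by blast
    qed
  qed
qed

definition adjoin :: "'v set \<Rightarrow> 'v \<Rightarrow> 'v set" where
  "adjoin A x = {a + c *s x | a c. a \<in> A \<and> c \<in> \<O>}"

lemma submodule_adjoin:
  assumes "submodule A" "x \<in> V" shows "submodule (adjoin A x)"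
  unfolding submodule_def
proof (intro conjI ballI)
  note A = submoduleD[OF assms(1)]
  show "adjoin A x \<subseteq> V"
    using A(1) assms(2) subspace_add[OF subspace_V] subspace_scale[OF subspace_V]
    by (auto simp: adjoin_def)
  show "0 \<in> adjoin A x"
    using A(2) by (auto simp: adjoin_def intro!: exI[of _ 0])
  show "u + v \<in> adjoin A x" if uv: "u \<in> adjoin A x" "v \<in> adjoin A x" for u v
  proof -
    from uv obtain a c b d where *: "u = a + c *s x" "v = b + d *s x" "a \<in> A" "c \<in> \<O>" "b \<in> A" "d \<in> \<O>"
      by (auto simp: adjoin_def)
    then have "u + v = (a + b) + (c + d) *s x" by (simp add: algebra_simps scale_left_distrib)
    then show ?thesis using * A(3) integers_add unfolding adjoin_def by blast
  qed
  show "e *s u \<in> adjoin A x" if e: "e \<in> \<O>" "u \<in> adjoin A x" for e u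
  proof -
    from e obtain a c where *: "u = a + c *s x" "a \<in> A" "c \<in> \<O>" by (auto simp: adjoin_def)
    then have "e *s u = e *s a + (e * c) *s x" by (simp add: scale_right_distrib)
    then show ?thesis using * e A(4) integers_mult unfolding adjoin_def by blast
  qed
qed

lemma adjoin_superset: "A \<subseteq> adjoin A x"
proof
  fix a assume "a \<in> A"
  then have "a = a + 0 *s x" "a \<in> A" "0 \<in> \<O>" by auto
  then show "a \<in> adjoin A x" unfolding adjoin_def by blast
qed

lemma adjoin_mem: "submodule A \<Longrightarrow> x \<in> adjoin A x"
  using submoduleD(2)[of A] unfolding adjoin_def
  by (auto intro!: exI[of _ 0] exI[of _ 1])

lemma adjoin_least: "submodule M \<Longrightarrow> A \<subseteq> M \<Longrightarrow> x \<in> M \<Longrightarrow> adjoin A x \<subseteq> M"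
  using submoduleD(3,4)[of M] unfolding adjoin_def by blast

section \<open>Indices of submodules\<close>

definition coset :: "'v set \<Rightarrow> 'v \<Rightarrow> 'v set" where
  "coset A x = {y. y - x \<in> A}"

definition quot :: "'v set \<Rightarrow> 'v set \<Rightarrow> 'v set set" where
  "quot B A = coset A ` B"

lemma coset_eq_iff:
  assumes "submodule A" shows "coset A x = coset A y \<longleftrightarrow> x - y \<in> A"
proof
  assume "coset A x = coset A y"
  moreover have "x \<in> coset A x" using submoduleD(2)[OF assms] by (simp add: coset_def)
  ultimately have "x \<in> coset A y" by simp
  then show "x - y \<in> A" by (simp add: coset_def)
next
  assume xy: "x - y \<in> A"
  show "coset A x = coset A y"
    unfolding coset_def
  proof (rule Collect_cong)
    fix z
    show "z - x \<in> A \<longleftrightarrow> z - y \<in> A"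
      using submoduleD(3)[OF assms _ xy, of "z - x"] submodule_diff[OF assms _ xy, of "z - y"] by auto
  qed
qed

lemma coset_eq_self_iff:
  assumes "submodule A" shows "coset A x = A \<longleftrightarrow> x \<in> A"
  using coset_eq_iff[OF assms, of x 0] by (simp add: coset_def)

lemma Union_quot:
  assumes "submodule A" "submodule B" "A \<subseteq> B" shows "\<Union>(quot B A) = B"
proof -
  have "y \<in> B" if "y - x \<in> A" "x \<in> B" for x y
    using submoduleD(3)[OF assms(2), of "y - x" x] that assms(3) by auto
  then show ?thesis using submoduleD(2)[OF assms(1)] by (force simp: quot_def coset_def)
qed

text \<open>
  Each coset of \<open>M\<close> in \<open>B\<close> is a union of cosets of \<open>A\<close>, and translation identifies the set of these
  with the cosets of \<open>A\<close> in \<open>M\<close>.  Cosets are plain sets, so the cosets of \<open>A\<close> inside a given coset \<open>Y\<close> of \<open>M\<close>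
  are simply the subsets \<open>X \<subseteq> Y\<close> among them.
\<close>

lemma card_quot_mult:
  assumes A: "submodule A" and M: "submodule M" and B: "submodule B" and sub: "A \<subseteq> M" "M \<subseteq> B"
    and fin: "finite (quot B A)"
  shows "card (quot B A) = card (quot M A) * card (quot B M)"
proof -
  define fib where "fib Y = {X \<in> quot B A. X \<subseteq> Y}" for Y
  have sub_iff: "coset A x \<subseteq> coset M y \<longleftrightarrow> x - y \<in> M" for x y
  proof
    assume "coset A x \<subseteq> coset M y"
    moreover have "x \<in> coset A x" using submoduleD(2)[OF A] by (simp add: coset_def)
    ultimately have "x \<in> coset M y" by blast
    then show "x - y \<in> M" by (simp add: coset_def)
  next
    assume xy: "x - y \<in> M"
    show "coset A x \<subseteq> coset M y"
    proof
      fix z assume "z \<in> coset A x"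
      then have "z - x \<in> M" using sub by (auto simp: coset_def)
      then show "z \<in> coset M y" using submoduleD(3)[OF M _ xy, of "z - x"] by (simp add: coset_def)
    qed
  qed
  have fib_card: "card (fib (coset M y)) = card (quot M A)" if y: "y \<in> B" for y
  proof -
    have "bij_betw ((`) ((+) y)) (quot M A) (fib (coset M y))"
      unfolding bij_betw_def
    proof
      show "inj_on ((`) ((+) y)) (quot M A)"
        by (rule inj_onI) (simp add: inj_image_eq_iff)
      have tr: "(+) y ` coset A x = coset A (y + x)" for x
      proof
        show "(+) y ` coset A x \<subseteq> coset A (y + x)" by (auto simp: coset_def)
        show "coset A (y + x) \<subseteq> (+) y ` coset A x"
        proof
          fix z assume "z \<in> coset A (y + x)"
          then have "z = y + (z - y)" "z - y \<in> coset A x" by (auto simp: coset_def algebra_simps)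
          then show "z \<in> (+) y ` coset A x" by blast
        qed
      qed
      show "(`) ((+) y) ` quot M A = fib (coset M y)"
      proof
        show "(`) ((+) y) ` quot M A \<subseteq> fib (coset M y)"
        proof
          fix X assume "X \<in> (`) ((+) y) ` quot M A"
          then obtain x where x: "X = coset A (y + x)" "x \<in> M" by (auto simp: quot_def tr)
          then have "y + x \<in> B" using sub y submoduleD(3)[OF B] by blast
          then show "X \<in> fib (coset M y)" using x by (simp add: quot_def fib_def sub_iff)
        qed
        show "fib (coset M y) \<subseteq> (`) ((+) y) ` quot M A"
        proof
          fix X assume "X \<in> fib (coset M y)"
          then obtain x where x: "X = coset A x" "x - y \<in> M" by (auto simp: fib_def quot_def sub_iff)
          then have "X = (+) y ` coset A (x - y)" by (simp add: tr)
          then show "X \<in> (`) ((+) y) ` quot M A" using x by (auto simp: quot_def)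
        qed
      qed
    qed
    then show ?thesis by (simp add: bij_betw_same_card)
  qed
  have "quot B M = (\<lambda>X. coset M (SOME x. x \<in> X)) ` quot B A"
  proof -
    have "coset M (SOME z. z \<in> coset A x) = coset M x" for x
    proof -
      have "x \<in> coset A x" using submoduleD(2)[OF A] by (simp add: coset_def)
      then have "(SOME z. z \<in> coset A x) \<in> coset A x" by (rule someI)
      then show ?thesis using sub coset_eq_iff[OF M] by (auto simp: coset_def)
    qed
    then show ?thesis by (simp add: quot_def image_image)
  qed
  then have finM: "finite (quot B M)" using fin by simp
  have un: "quot B A = (\<Union>Y\<in>quot B M. fib Y)"
  proof -
    have "coset A x \<in> fib (coset M x)" if "x \<in> B" for x
      using that submoduleD(2)[OF M] by (simp add: fib_def quot_def sub_iff)
    then show ?thesis unfolding quot_def[of B M] by (auto simp: quot_def[of B A] fib_def)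
  qed
  have dis: "fib Y \<inter> fib Y' = {}" if Y: "Y \<in> quot B M" "Y' \<in> quot B M" "Y \<noteq> Y'" for Y Y'
  proof (rule ccontr)
    assume "fib Y \<inter> fib Y' \<noteq> {}"
    then obtain x where x: "coset A x \<subseteq> Y" "coset A x \<subseteq> Y'" by (auto simp: fib_def quot_def)
    obtain y y' where "Y = coset M y" "Y' = coset M y'" using Y unfolding quot_def by blast
    then have "Y = coset M x" "Y' = coset M x" using x sub_iff coset_eq_iff[OF M] by metis+
    then show False using Y by simp
  qed
  have "card (quot B A) = (\<Sum>Y\<in>quot B M. card (fib Y))"
    unfolding un using finM fin dis by (intro card_UN_disjoint) (auto simp: fib_def)
  also have "\<dots> = (\<Sum>Y\<in>quot B M. card (quot M A))"
    by (rule sum.cong) (auto simp: quot_def[of B M] fib_card)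
  finally show ?thesis by simp
qed

text \<open>
  As \<open>\<pi> x \<in> A\<close> but \<open>x \<notin> A\<close>, the scalars \<open>c \<in> \<O>\<close> with \<open>c x \<in> A\<close> form the maximal ideal; so \<open>c\<close> modulo \<open>\<pi>\<close>
  parametrises the cosets.
\<close>

lemma card_quot_adjoin:
  assumes A: "submodule A" and x: "x \<in> V" "x \<notin> A" "\<pi> *s x \<in> A"
  shows "card (quot (adjoin A x) A) = q"
proof -
  obtain T where T: "finite T" "card T = q" "T \<subseteq> \<O>"
    "\<And>c. c \<in> \<O> \<Longrightarrow> \<exists>u\<in>T. (c - u) / \<pi> \<in> \<O>"
    "\<And>u v. u \<in> T \<Longrightarrow> v \<in> T \<Longrightarrow> (u - v) / \<pi> \<in> \<O> \<Longrightarrow> u = v"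
    using residue_representatives by metis
  have iff: "c *s x \<in> A \<longleftrightarrow> c / \<pi> \<in> \<O>" if "c \<in> \<O>" for c
  proof
    assume c: "c *s x \<in> A"
    show "c / \<pi> \<in> \<O>"
      using that
    proof (cases rule: divide_uniformizer_cases)
      case 2
      then have "inverse c *s (c *s x) \<in> A" using c submoduleD(4)[OF A] by blast
      then show ?thesis using 2 x by simp
    qed
  next
    assume "c / \<pi> \<in> \<O>"
    then have "(c / \<pi>) *s (\<pi> *s x) \<in> A" using x submoduleD(4)[OF A] by blast
    then show "c *s x \<in> A" using uniformizer by simp
  qed
  have "bij_betw (\<lambda>u. coset A (u *s x)) T (quot (adjoin A x) A)"
    unfolding bij_betw_def
  proof
    show "inj_on (\<lambda>u. coset A (u *s x)) T"
    proof (rule inj_onI)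
      fix u v assume uv: "u \<in> T" "v \<in> T" "coset A (u *s x) = coset A (v *s x)"
      then have "(u - v) *s x \<in> A" by (simp add: coset_eq_iff[OF A] scale_left_diff_distrib)
      moreover have "u - v \<in> \<O>" using uv T(3) integers_diff by blast
      ultimately show "u = v" using T(5)[OF uv(1,2)] iff by blast
    qed
    show "(\<lambda>u. coset A (u *s x)) ` T = quot (adjoin A x) A"
    proof
      show "(\<lambda>u. coset A (u *s x)) ` T \<subseteq> quot (adjoin A x) A"
      proof
        fix X assume "X \<in> (\<lambda>u. coset A (u *s x)) ` T"
        then obtain u where u: "u \<in> T" "X = coset A (u *s x)" by auto
        then have "u *s x \<in> adjoin A x"
          using T submoduleD(4)[OF submodule_adjoin[OF A x(1)]] adjoin_mem[OF A] by blast
        then show "X \<in> quot (adjoin A x) A" using u by (auto simp: quot_def)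
      qed
      show "quot (adjoin A x) A \<subseteq> (\<lambda>u. coset A (u *s x)) ` T"
      proof
        fix X assume "X \<in> quot (adjoin A x) A"
        then obtain a c where X: "X = coset A (a + c *s x)" "a \<in> A" "c \<in> \<O>"
          by (auto simp: quot_def adjoin_def)
        obtain u where u: "u \<in> T" "(c - u) / \<pi> \<in> \<O>" using T(4)[OF X(3)] by blast
        then have "(c - u) *s x \<in> A" using iff[of "c - u"] X(3) T(3) integers_diff by blast
        then have "a + (c - u) *s x \<in> A" using X submoduleD(3)[OF A] by blast
        then have "X = coset A (u *s x)"
          by (simp add: X coset_eq_iff[OF A] scale_left_diff_distrib algebra_simps)
        then show "X \<in> (\<lambda>u. coset A (u *s x)) ` T" using u by blast
      qed
    qed
  qed
  then show ?thesis using T bij_betw_same_card by metis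
qed

text \<open>
  This says that \<open>B / A\<close> is a vector space of dimension \<open>d\<close> over the residue field.  Dimension is
  expressed by counting cosets, so that no vector space structure has to be put on the quotient;
  \<open>layer A B 1\<close> says that \<open>B\<close> covers \<open>A\<close>.
\<close>

definition layer :: "'v set \<Rightarrow> 'v set \<Rightarrow> nat \<Rightarrow> bool" where
  "layer A B d \<longleftrightarrow> submodule A \<and> submodule B \<and> A \<subseteq> B \<and> dilate \<pi> B \<subseteq> A \<and> card (quot B A) = q ^ d"

lemma layerD:
  assumes "layer A B d"
  shows "submodule A" "submodule B" "A \<subseteq> B" "dilate \<pi> B \<subseteq> A" "card (quot B A) = q ^ d"
  using assms by (auto simp: layer_def)

lemma finite_quot: "layer A B d \<Longrightarrow> finite (quot B A)"
  using layerD(5)[of A B d] one_less_q by (intro card_ge_0_finite) simp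

lemma layer_unique: "layer A B d \<Longrightarrow> layer A B e \<Longrightarrow> d = e"
  using layerD(5)[of A B d] layerD(5)[of A B e] one_less_q by simp

lemma quot_mem_bottom: "submodule A \<Longrightarrow> submodule B \<Longrightarrow> A \<in> quot B A"
  using coset_eq_self_iff[of A 0] submoduleD(2)[of A] submoduleD(2)[of B] by (force simp: quot_def)

lemma layer_zero_imp_eq:
  assumes "layer A B 0" shows "A = B"
proof -
  note l = layerD[OF assms]
  have "quot B A = {A}"
    using l(5) quot_mem_bottom[OF l(1,2)] by (auto simp: card_1_singleton_iff)
  then show ?thesis using Union_quot[OF l(1-3)] by simp
qed

lemma layer_refl:
  assumes "submodule A" shows "layer A A 0"
proof -
  have "quot A A = {A}"
    using coset_eq_self_iff[OF assms] submoduleD(2)[OF assms] by (auto simp: quot_def)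
  then show ?thesis using assms dilate_integral_subset[OF assms] by (simp add: layer_def)
qed

lemma layer_same_iff: "layer A A d \<longleftrightarrow> submodule A \<and> d = 0"
  using layer_refl layer_unique layerD(1) by blast

lemma layer_psubset:
  assumes "layer A B d" "d \<noteq> 0" shows "A \<subset> B"
proof -
  have "A \<noteq> B" using assms layer_same_iff by metis
  then show ?thesis using layerD(3)[OF assms(1)] by simp
qed

text \<open>
  A line in \<open>B / A\<close> is spanned by any nonzero vector.
\<close>

lemma layer_adjoin:
  assumes l: "layer A B d" and x: "x \<in> B" "x \<notin> A"
  shows "layer A (adjoin A x) 1" "adjoin A x \<subseteq> B"
proof -
  note l = layerD[OF l]
  have V: "x \<in> V" and \<pi>x: "\<pi> *s x \<in> A" using x l submoduleD(1)[OF l(2)] by auto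
  show sub: "adjoin A x \<subseteq> B" by (rule adjoin_least) (use l x in auto)
  have "dilate \<pi> (adjoin A x) \<subseteq> A" using sub l(4) by blast
  then show "layer A (adjoin A x) 1"
    using l V x \<pi>x by (simp add: layer_def submodule_adjoin adjoin_superset card_quot_adjoin)
qed

lemma ex_layer_1:
  assumes "layer A B d" "A \<noteq> B"
  obtains M where "layer A M 1" "M \<subseteq> B"
  using layer_adjoin[OF assms(1)] layerD(3)[OF assms(1)] assms(2) by blast

lemma layer_above_cover:
  assumes l: "layer A B d" and M: "layer A M 1" "M \<subseteq> B"
  obtains d' where "d = Suc d'" "layer M B d'"
proof -
  note lD = layerD[OF l] and MD = layerD[OF M(1)]
  have *: "q ^ d = q * card (quot B M)"
    using card_quot_mult[OF MD(1,2) lD(2) MD(3) M(2) finite_quot[OF l]] lD(5) MD(5) by simp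
  show thesis
  proof (cases d)
    case 0
    then show ?thesis using * one_less_q by simp
  next
    case (Suc d')
    then have "card (quot B M) = q ^ d'" using * one_less_q by simp
    then have "layer M B d'" using lD MD M by (auto simp: layer_def)
    then show ?thesis using Suc that by blast
  qed
qed

text \<open>
  Climb from \<open>A\<close> to \<open>M\<close> by adjoining elements of \<open>M\<close> one at a time: each step uses up one dimension
  of \<open>B / A\<close>, so the index of \<open>A\<close> in \<open>M\<close> is a power of \<open>q\<close>.
\<close>

lemma layer_split:
  assumes "layer A B d" "submodule M" "A \<subseteq> M" "M \<subseteq> B"
  obtains e where "e \<le> d" "layer A M e" "layer M B (d - e)"
proof -
  have "\<exists>e\<le>d. layer A M e \<and> layer M B (d - e)"
    using assms
  proof (induction d arbitrary: A)
    case 0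
    then have "A = B" using layer_zero_imp_eq by blast
    then show ?case using 0 by auto
  next
    case (Suc d)
    show ?case
    proof (cases "A = M")
      case True
      then show ?thesis using Suc.prems layer_refl by auto
    next
      case False
      then obtain x where x: "x \<in> M" "x \<notin> A" using Suc.prems by blast
      let ?A = "adjoin A x"
      have A1: "layer A ?A 1" "?A \<subseteq> B" using layer_adjoin[OF Suc.prems(1)] x Suc.prems by auto
      then have "layer ?A B d" using layer_above_cover[OF Suc.prems(1)] by blast
      moreover have sub: "?A \<subseteq> M" by (rule adjoin_least) (use x Suc.prems in auto)
      ultimately obtain e where e: "e \<le> d" "layer ?A M e" "layer M B (d - e)"
        using Suc.IH Suc.prems by blast
      have "finite (quot M A)"
        using Suc.prems(4) by (intro finite_subset[OF _ finite_quot[OF Suc.prems(1)]]) (auto simp: quot_def)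
      then have "card (quot M A) = q ^ Suc e"
        using card_quot_mult[of A ?A M] layerD[OF A1(1)] layerD[OF e(2)] by simp
      then have "layer A M (Suc e)"
        using Suc.prems layerD[OF Suc.prems(1)] order_trans[OF image_mono[OF Suc.prems(4)]]
        by (simp add: layer_def)
      then show ?thesis using e by (intro exI[of _ "Suc e"]) simp
    qed
  qed
  then show thesis using that by blast
qed

lemma layer_1_between:
  assumes "layer A B 1" "submodule M" "A \<subseteq> M" "M \<subseteq> B"
  shows "M = A \<or> M = B"
proof -
  obtain e where e: "e \<le> 1" "layer A M e" "layer M B (1 - e)" using layer_split[OF assms] .
  then consider "e = 0" | "e = 1" by linarith
  then show ?thesis using e layer_zero_imp_eq[of A M] layer_zero_imp_eq[of M B] by cases auto
qed

lemma layer_2_between: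
  assumes "layer A B 2" "submodule M" "A \<subset> M" "M \<subset> B"
  shows "layer A M 1" "layer M B 1"
proof -
  obtain e where e: "e \<le> 2" "layer A M e" "layer M B (2 - e)"
    using layer_split[OF assms(1,2)] assms by blast
  then have "e \<noteq> 0" "e \<noteq> 2" using layer_zero_imp_eq[of A M] layer_zero_imp_eq[of M B] assms by auto
  then have "e = 1" using e by linarith
  then show "layer A M 1" "layer M B 1" using e by auto
qed

lemma layer_dilate:
  assumes "layer A B d" "\<alpha> \<noteq> 0"
  shows "layer (dilate \<alpha> A) (dilate \<alpha> B) d"
proof -
  note l = layerD[OF assms(1)]
  have coset: "coset (dilate \<alpha> A) (\<alpha> *s x) = dilate \<alpha> (coset A x)" for x
  proof
    show "coset (dilate \<alpha> A) (\<alpha> *s x) \<subseteq> dilate \<alpha> (coset A x)"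
    proof
      fix y assume "y \<in> coset (dilate \<alpha> A) (\<alpha> *s x)"
      then obtain a where a: "a \<in> A" "y - \<alpha> *s x = \<alpha> *s a" by (auto simp: coset_def)
      then have "y = \<alpha> *s (a + x)" by (simp add: scale_right_distrib algebra_simps)
      then show "y \<in> dilate \<alpha> (coset A x)" using a by (auto simp: coset_def)
    qed
    show "dilate \<alpha> (coset A x) \<subseteq> coset (dilate \<alpha> A) (\<alpha> *s x)"
      by (auto simp: coset_def simp flip: scale_right_diff_distrib)
  qed
  have "quot (dilate \<alpha> B) (dilate \<alpha> A) = dilate \<alpha> ` quot B A"
    by (simp add: quot_def image_image coset)
  moreover have "inj_on (dilate \<alpha>) (quot B A)"
    using dilate_eq_iff[OF assms(2)] by (auto simp: inj_on_def)
  ultimately have "card (quot (dilate \<alpha> B) (dilate \<alpha> A)) = q ^ d"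
    using l(5) by (simp add: card_image)
  moreover have "dilate \<pi> (dilate \<alpha> B) = dilate \<alpha> (dilate \<pi> B)"
    by (simp only: dilate_dilate mult.commute)
  ultimately show ?thesis
    using l assms(2) unfolding layer_def by (simp only: submodule_dilate dilate_subset_iff simp_thms)
qed

text \<open>
  A module between \<open>A\<close> and \<open>B\<close> is the union of its cosets of \<open>A\<close>, hence determined by a subset of a
  finite set.
\<close>

lemma finite_between:
  assumes "layer A B d"
  shows "finite {M. submodule M \<and> A \<subseteq> M \<and> M \<subseteq> B}"
proof (rule finite_subset)
  show "{M. submodule M \<and> A \<subseteq> M \<and> M \<subseteq> B} \<subseteq> Union ` Pow (quot B A)"
  proof
    fix M assume M: "M \<in> {M. submodule M \<and> A \<subseteq> M \<and> M \<subseteq> B}"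
    then have "M = \<Union>(quot M A)" using Union_quot layerD(1)[OF assms] by auto
    moreover have "quot M A \<subseteq> quot B A" using M by (auto simp: quot_def)
    ultimately show "M \<in> Union ` Pow (quot B A)" by blast
  qed
  show "finite (Union ` Pow (quot B A))" using finite_quot[OF assms] by simp
qed

text \<open>
  The lines of a \<open>d\<close>-dimensional space partition its nonzero vectors into sets of size \<open>q - 1\<close>.  Here the
  vectors are cosets of \<open>A\<close>, and the zero vector is \<open>A\<close> itself.
\<close>

lemma card_covers:
  assumes l: "layer A B d"
  shows "card {M. layer A M 1 \<and> M \<subseteq> B} * (q - 1) = q ^ d - 1"
proof -
  note lD = layerD[OF l]
  let ?C = "{M. layer A M 1 \<and> M \<subseteq> B}"
  have fin: "finite ?C"
    by (rule finite_subset[OF _ finite_between[OF l]]) (blast dest: layerD(2,3))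
  have un: "quot B A - {A} = (\<Union>M\<in>?C. quot M A - {A})"
  proof
    show "quot B A - {A} \<subseteq> (\<Union>M\<in>?C. quot M A - {A})"
    proof
      fix X assume "X \<in> quot B A - {A}"
      then obtain x where x: "X = coset A x" "x \<in> B" "x \<notin> A" "X \<noteq> A"
        using coset_eq_self_iff[OF lD(1)] by (auto simp: quot_def)
      then have "X \<in> quot (adjoin A x) A" using adjoin_mem[OF lD(1)] by (auto simp: quot_def)
      then show "X \<in> (\<Union>M\<in>?C. quot M A - {A})" using layer_adjoin[OF l x(2,3)] x(4) by blast
    qed
    show "(\<Union>M\<in>?C. quot M A - {A}) \<subseteq> quot B A - {A}" by (auto simp: quot_def)
  qed
  have disj: "(quot M A - {A}) \<inter> (quot M' A - {A}) = {}" if M: "M \<in> ?C" "M' \<in> ?C" "M \<noteq> M'" for M M'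
  proof (rule ccontr)
    assume "(quot M A - {A}) \<inter> (quot M' A - {A}) \<noteq> {}"
    then obtain x x' where x: "x \<in> M" "x' \<in> M'" "coset A x = coset A x'" "coset A x \<noteq> A"
      by (auto simp: quot_def)
    note MD = layerD[of A M 1] layerD[of A M' 1]
    have "x - x' \<in> M'" using x(3) coset_eq_iff[OF lD(1)] MD(8) M by auto
    then have "x \<in> M'" using submoduleD(3)[of M' "x - x'" x'] x(2) MD(7) M by auto
    have I: "submodule (M \<inter> M')" "A \<subseteq> M \<inter> M'" using MD M submodule_Int by auto
    have "x \<notin> A" using x(4) coset_eq_self_iff[OF lD(1)] by simp
    then have "M \<inter> M' \<noteq> A" using x(1) \<open>x \<in> M'\<close> by blast
    then have "M \<inter> M' = M" "M \<inter> M' = M'"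
      using layer_1_between[of A M "M \<inter> M'"] layer_1_between[of A M' "M \<inter> M'"] M I by auto
    then show False using M by simp
  qed
  have one: "card (quot M A - {A}) = q - 1" "finite (quot M A)" if "M \<in> ?C" for M
    using that quot_mem_bottom[of A M] layerD[of A M 1] finite_quot[of A M 1] by simp_all
  have "q ^ d - 1 = card (quot B A - {A})"
    using quot_mem_bottom[OF lD(1,2)] lD(5) finite_quot[OF l] by simp
  also have "\<dots> = (\<Sum>M\<in>?C. card (quot M A - {A}))"
    unfolding un using fin one(2) disj by (intro card_UN_disjoint) auto
  also have "\<dots> = card ?C * (q - 1)" using one(1) by simp
  finally show ?thesis by simp
qed

end

section \<open>Complete flags of submodules\<close>

context local_field
begin

text \<open>
  The number of complete flags of a \<open>d\<close>-dimensional space over the field with \<open>q\<close> elements.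
\<close>

definition flag_number :: "nat \<Rightarrow> nat" where
  "flag_number d = (\<Prod>i<d. (q ^ Suc i - 1) div (q - 1))"

lemma flag_number_pos: "0 < flag_number d"
proof -
  have "0 < (q ^ Suc i - 1) div (q - 1)" for i
  proof -
    have "q - 1 \<le> q ^ Suc i - 1"
      using one_less_q by (intro diff_le_mono self_le_power) auto
    then show ?thesis using one_less_q by (simp add: div_greater_zero_iff del: power_Suc)
  qed
  then show ?thesis unfolding flag_number_def by (intro prod_pos) simp
qed

end

context building
begin

text \<open>
  The half-open form makes flags composable: a flag of \<open>(A, M]\<close> and one of \<open>(M, B]\<close> are disjoint, and
  their union is a flag of \<open>(A, B]\<close>.  It also matches the normalized representatives of vertices, for
  which \<open>L\<close> but not \<open>\<pi> L\<close> is admitted.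
\<close>

definition interval :: "'v set \<Rightarrow> 'v set \<Rightarrow> 'v set set" where
  "interval A B = {M. submodule M \<and> A \<subset> M \<and> M \<subseteq> B}"

definition flags :: "'v set \<Rightarrow> 'v set \<Rightarrow> 'v set set set" where
  "flags A B = {C. subset.maxchain (interval A B) C}"

text \<open>
  A chain is maximal iff it contains every element comparable to all of its members.  Maximality is
  used in this elementwise form throughout.
\<close>

lemma flags_iff:
  "C \<in> flags A B \<longleftrightarrow> C \<subseteq> interval A B \<and> (\<forall>X\<in>C. \<forall>Y\<in>C. X \<subseteq> Y \<or> Y \<subseteq> X) \<and>
     (\<forall>N\<in>interval A B. (\<forall>X\<in>C. X \<subseteq> N \<or> N \<subseteq> X) \<longrightarrow> N \<in> C)"
    (is "_ \<longleftrightarrow> ?sub \<and> ?chain \<and> ?max")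
proof
  assume "C \<in> flags A B"
  then have C: "subset.chain (interval A B) C"
    and max: "\<And>D. subset.chain (interval A B) D \<Longrightarrow> C \<subseteq> D \<Longrightarrow> D = C"
    by (auto simp: flags_def subset.maxchain_def)
  have "N \<in> C" if N: "N \<in> interval A B" "\<forall>X\<in>C. X \<subseteq> N \<or> N \<subseteq> X" for N
  proof -
    have "subset.chain (interval A B) (insert N C)"
      using C N unfolding subset_chain_def by blast
    then have "insert N C = C" by (rule max) blast
    then show ?thesis by (rule subst) simp
  qed
  then show "?sub \<and> ?chain \<and> ?max" using C by (simp add: subset_chain_def)
next
  assume C: "?sub \<and> ?chain \<and> ?max"
  have "\<not> C \<subset> D" if D: "subset.chain (interval A B) D" for D
  proof
    assume "C \<subset> D"
    then obtain N where "N \<in> D" "N \<notin> C" by blast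
    moreover have "\<forall>X\<in>C. X \<subseteq> N \<or> N \<subseteq> X"
      using D psubset_imp_subset[OF \<open>C \<subset> D\<close>] \<open>N \<in> D\<close> unfolding subset_chain_def by blast
    moreover have "N \<in> interval A B" using D \<open>N \<in> D\<close> unfolding subset_chain_def by blast
    ultimately show False using C by blast
  qed
  moreover have "subset.chain (interval A B) C" using C by (simp add: subset_chain_def)
  ultimately show "C \<in> flags A B" unfolding flags_def subset.maxchain_def by blast
qed

lemma flagI:
  assumes "\<And>X. X \<in> C \<Longrightarrow> submodule X \<and> A \<subset> X \<and> X \<subseteq> B"
    "\<And>X Y. X \<in> C \<Longrightarrow> Y \<in> C \<Longrightarrow> X \<subseteq> Y \<or> Y \<subseteq> X"
    "\<And>N. submodule N \<Longrightarrow> A \<subset> N \<Longrightarrow> N \<subseteq> B \<Longrightarrow> \<forall>X\<in>C. X \<subseteq> N \<or> N \<subseteq> X \<Longrightarrow> N \<in> C"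
  shows "C \<in> flags A B"
  unfolding flags_iff
proof (intro conjI subsetI ballI impI)
  show "X \<in> interval A B" if "X \<in> C" for X using assms(1)[OF that] by (simp add: interval_def)
  show "X \<subseteq> Y \<or> Y \<subseteq> X" if "X \<in> C" "Y \<in> C" for X Y using assms(2)[OF that] .
  show "N \<in> C" if "N \<in> interval A B" "\<forall>X\<in>C. X \<subseteq> N \<or> N \<subseteq> X" for N
    using assms(3)[of N] that by (simp add: interval_def)
qed

lemma flagD:
  assumes "C \<in> flags A B"
  shows "\<And>X. X \<in> C \<Longrightarrow> submodule X" "\<And>X. X \<in> C \<Longrightarrow> A \<subset> X" "\<And>X. X \<in> C \<Longrightarrow> X \<subseteq> B"
    and flag_comparable: "\<And>X Y. X \<in> C \<Longrightarrow> Y \<in> C \<Longrightarrow> X \<subseteq> Y \<or> Y \<subseteq> X"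
    and flag_maximal: "\<And>N. submodule N \<Longrightarrow> A \<subset> N \<Longrightarrow> N \<subseteq> B \<Longrightarrow> \<forall>X\<in>C. X \<subseteq> N \<or> N \<subseteq> X \<Longrightarrow> N \<in> C"
proof -
  have C: "C \<subseteq> interval A B" "\<forall>X\<in>C. \<forall>Y\<in>C. X \<subseteq> Y \<or> Y \<subseteq> X"
    "\<forall>N\<in>interval A B. (\<forall>X\<in>C. X \<subseteq> N \<or> N \<subseteq> X) \<longrightarrow> N \<in> C"
    using iffD1[OF flags_iff assms] by blast+
  show "submodule X" "A \<subset> X" "X \<subseteq> B" if "X \<in> C" for X
    using subsetD[OF C(1) that] by (simp_all add: interval_def)
  show "X \<subseteq> Y \<or> Y \<subseteq> X" if "X \<in> C" "Y \<in> C" for X Y using C(2) that by simp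
  show "N \<in> C" if "submodule N" "A \<subset> N" "N \<subseteq> B" "\<forall>X\<in>C. X \<subseteq> N \<or> N \<subseteq> X" for N
    using C(3) that by (simp add: interval_def)
qed

lemma top_in_flag:
  assumes "C \<in> flags A B" "submodule B" "A \<subset> B" shows "B \<in> C"
  using flag_maximal[OF assms(1,2,3)] flagD(3)[OF assms(1)] by simp

lemma finite_interval: "layer A B d \<Longrightarrow> finite (interval A B)"
  by (rule finite_subset[OF _ finite_between]) (auto simp: interval_def)

lemma finite_flags: "layer A B d \<Longrightarrow> finite (flags A B)"
  by (rule finite_subset[of _ "Pow (interval A B)"]) (auto simp: flags_iff finite_interval)

lemma flag_concat:
  assumes M: "submodule M" "A \<subseteq> M" "M \<subseteq> B" and D: "D \<in> flags A M" and E: "E \<in> flags M B"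
  shows "D \<union> E \<in> flags A B" "M \<in> insert A D"
proof -
  show MD: "M \<in> insert A D"
    using top_in_flag[OF D M(1)] M(2) by (cases "A = M") auto
  have below: "X \<subseteq> Y" if "X \<in> D" "Y \<in> E" for X Y
    using flagD(3)[OF D that(1)] flagD(2)[OF E that(2)] by (meson order_trans psubset_imp_subset)
  show "D \<union> E \<in> flags A B"
  proof (rule flagI)
    fix X assume "X \<in> D \<union> E"
    then show "submodule X \<and> A \<subset> X \<and> X \<subseteq> B"
    proof
      assume "X \<in> D"
      then show ?thesis using flagD(1-3)[OF D, of X] M(3) by (simp add: order_trans)
    next
      assume "X \<in> E"
      then show ?thesis using flagD(1-3)[OF E, of X] M(2) by (simp add: order_le_less_trans)
    qed
  next
    fix X Y assume XY: "X \<in> D \<union> E" "Y \<in> D \<union> E"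
    then consider "X \<in> D" "Y \<in> D" | "X \<in> E" "Y \<in> E" | "X \<in> D" "Y \<in> E" | "X \<in> E" "Y \<in> D"
      by fast
    then show "X \<subseteq> Y \<or> Y \<subseteq> X"
      using flag_comparable[OF D, of X Y] flag_comparable[OF E, of X Y] below[of X Y] below[of Y X]
      by cases simp_all
  next
    fix N assume N: "submodule N" "A \<subset> N" "N \<subseteq> B" "\<forall>X\<in>D \<union> E. X \<subseteq> N \<or> N \<subseteq> X"
    have cmp: "\<forall>X\<in>D. X \<subseteq> N \<or> N \<subseteq> X" "\<forall>X\<in>E. X \<subseteq> N \<or> N \<subseteq> X" using N(4) by simp_all
    have "M \<subseteq> N \<or> N \<subseteq> M" using MD N(2,4) by (cases "M = A") (simp_all add: psubset_imp_subset)
    then consider "M \<subset> N" | "N \<subseteq> M" by (metis order_le_less)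
    then show "N \<in> D \<union> E"
      using flag_maximal[OF D N(1,2) _ cmp(1)] flag_maximal[OF E N(1) _ N(3) cmp(2)]
      by cases simp_all
  qed
qed

lemma flag_cut:
  assumes AMB: "A \<subseteq> M" "M \<subseteq> B" and C: "C \<in> flags A B" and M: "M \<in> insert A C"
  shows "{X \<in> C. X \<subseteq> M} \<in> flags A M" "{X \<in> C. M \<subset> X} \<in> flags M B"
    "{X \<in> C. X \<subseteq> M} \<union> {X \<in> C. M \<subset> X} = C"
proof -
  have cmp: "X \<subseteq> M \<or> M \<subset> X" if X: "X \<in> C" for X
  proof (cases "M = A")
    case True
    then show ?thesis using flagD(2)[OF C X] by simp
  next
    case False
    then show ?thesis using flag_comparable[OF C X, of M] M by (auto simp: order_le_less)
  qed
  then show "{X \<in> C. X \<subseteq> M} \<union> {X \<in> C. M \<subset> X} = C" by fast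
  show "{X \<in> C. X \<subseteq> M} \<in> flags A M"
  proof (rule flagI)
    fix X assume "X \<in> {X \<in> C. X \<subseteq> M}"
    then show "submodule X \<and> A \<subset> X \<and> X \<subseteq> M" using flagD(1,2)[OF C, of X] by simp
  next
    fix X Y assume "X \<in> {X \<in> C. X \<subseteq> M}" "Y \<in> {X \<in> C. X \<subseteq> M}"
    then show "X \<subseteq> Y \<or> Y \<subseteq> X" using flag_comparable[OF C] by simp
  next
    fix N assume N: "submodule N" "A \<subset> N" "N \<subseteq> M" "\<forall>X\<in>{X \<in> C. X \<subseteq> M}. X \<subseteq> N \<or> N \<subseteq> X"
    have "\<forall>X\<in>C. X \<subseteq> N \<or> N \<subseteq> X"
    proof
      fix X assume X: "X \<in> C"
      show "X \<subseteq> N \<or> N \<subseteq> X"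
        using cmp[OF X] N(3,4) X by (metis (no_types, lifting) mem_Collect_eq order_trans psubset_imp_subset)
    qed
    then show "N \<in> {X \<in> C. X \<subseteq> M}"
      using flag_maximal[OF C N(1,2)] order_trans[OF N(3) AMB(2)] N(3) by simp
  qed
  show "{X \<in> C. M \<subset> X} \<in> flags M B"
  proof (rule flagI)
    fix X assume "X \<in> {X \<in> C. M \<subset> X}"
    then show "submodule X \<and> M \<subset> X \<and> X \<subseteq> B" using flagD(1,3)[OF C, of X] by simp
  next
    fix X Y assume "X \<in> {X \<in> C. M \<subset> X}" "Y \<in> {X \<in> C. M \<subset> X}"
    then show "X \<subseteq> Y \<or> Y \<subseteq> X" using flag_comparable[OF C] by simp
  next
    fix N assume N: "submodule N" "M \<subset> N" "N \<subseteq> B" "\<forall>X\<in>{X \<in> C. M \<subset> X}. X \<subseteq> N \<or> N \<subseteq> X"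
    have "\<forall>X\<in>C. X \<subseteq> N \<or> N \<subseteq> X"
    proof
      fix X assume X: "X \<in> C"
      show "X \<subseteq> N \<or> N \<subseteq> X"
        using cmp[OF X] N(2,4) X by (metis (no_types, lifting) mem_Collect_eq order_trans psubset_imp_subset)
    qed
    then show "N \<in> {X \<in> C. M \<subset> X}"
      using flag_maximal[OF C N(1) order_le_less_trans[OF AMB(1) N(2)] N(3)] N(2) by simp
  qed
qed

text \<open>
  Cutting a flag at its member \<open>M\<close> is inverse to concatenation.  The set \<open>insert A C\<close> allows \<open>M\<close> to be
  the excluded lower end \<open>A\<close>.
\<close>

lemma card_flags_through:
  assumes "submodule M" "A \<subseteq> M" "M \<subseteq> B"
  shows "card {C \<in> flags A B. M \<in> insert A C} = card (flags A M) * card (flags M B)"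
proof -
  have "bij_betw (\<lambda>(D, E). D \<union> E) (flags A M \<times> flags M B) {C \<in> flags A B. M \<in> insert A C}"
  proof (rule bij_betw_byWitness[where f' = "\<lambda>C. ({X \<in> C. X \<subseteq> M}, {X \<in> C. M \<subset> X})"])
    show "\<forall>a\<in>flags A M \<times> flags M B. (\<lambda>C. ({X \<in> C. X \<subseteq> M}, {X \<in> C. M \<subset> X})) (case a of (D, E) \<Rightarrow> D \<union> E) = a"
    proof (clarsimp)
      fix D E assume D: "D \<in> flags A M" and E: "E \<in> flags M B"
      have "X \<subseteq> M" if "X \<in> D" for X using flagD(3)[OF D that] .
      moreover have "M \<subset> X" if "X \<in> E" for X using flagD(2)[OF E that] .
      ultimately show "{X. (X \<in> D \<or> X \<in> E) \<and> X \<subseteq> M} = D \<and> {X. (X \<in> D \<or> X \<in> E) \<and> M \<subset> X} = E"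
        by (metis (lifting) Collect_cong Collect_mem_eq leD)
    qed
    show "\<forall>C\<in>{C \<in> flags A B. M \<in> insert A C}. (case ({X \<in> C. X \<subseteq> M}, {X \<in> C. M \<subset> X}) of (D, E) \<Rightarrow> D \<union> E) = C"
      using flag_cut(3)[OF assms(2,3)] by auto
    show "(\<lambda>(D, E). D \<union> E) ` (flags A M \<times> flags M B) \<subseteq> {C \<in> flags A B. M \<in> insert A C}"
      using flag_concat[OF assms] by auto
    show "(\<lambda>C. ({X \<in> C. X \<subseteq> M}, {X \<in> C. M \<subset> X})) ` {C \<in> flags A B. M \<in> insert A C} \<subseteq> flags A M \<times> flags M B"
      using flag_cut(1,2)[OF assms(2,3)] by auto
  qed
  then show ?thesis by (simp add: bij_betw_same_card[symmetric] card_cartesian_product)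
qed

text \<open>
  Take the largest \<open>M\<close> in \<open>insert A C\<close> of dimension at most \<open>i\<close> over \<open>A\<close>.  If its dimension were less than \<open>i\<close>, a
  cover of \<open>M\<close> inside the next member of the flag would be comparable to every member, hence would
  belong to the flag and contradict the choice of \<open>M\<close>.
\<close>

lemma flag_has_rank:
  assumes l: "layer A B d" and i: "i \<le> d" and C: "C \<in> flags A B"
  shows "\<exists>M\<in>insert A C. layer A M i"
proof -
  note lD = layerD[OF l]
  define S where "S = {M \<in> insert A C. \<exists>e\<le>i. layer A M e}"
  have fin: "finite C" by (rule finite_subset[OF _ finite_interval[OF l]]) (use C in \<open>simp add: flags_iff\<close>)
  have "A \<in> S" using layer_refl[OF lD(1)] by (auto simp: S_def)
  moreover have "finite S" using fin by (simp add: S_def)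
  ultimately obtain M where M: "M \<in> S" "\<forall>X\<in>S. M \<subseteq> X \<longrightarrow> M = X"
    using finite_has_maximal2[of S A] by blast
  from M(1) obtain e where e: "e \<le> i" "layer A M e" "M \<in> insert A C" by (auto simp: S_def)
  note MD = layerD[OF e(2)]
  have MB: "M \<subseteq> B" using e(3) flagD(3)[OF C, of M] lD(3) by (cases "M = A") simp_all
  have "e = i"
  proof (rule ccontr)
    assume "e \<noteq> i"
    then have "M \<noteq> B" using layer_unique[OF l, of e] e(1,2) i by auto
    then have "M \<subset> B" using MB by simp
    then have "B \<in> {X \<in> C. M \<subset> X}"
      using top_in_flag[OF C lD(2) order_le_less_trans[OF MD(3)]] by simp
    moreover have "finite {X \<in> C. M \<subset> X}" using fin by simp
    ultimately obtain N where "N \<in> {X \<in> C. M \<subset> X}" "\<forall>X\<in>{X \<in> C. M \<subset> X}. X \<subseteq> N \<longrightarrow> N = X"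
      using finite_has_minimal2[of "{X \<in> C. M \<subset> X}" B] by blast
    then have N: "N \<in> C" "M \<subset> N" "\<And>X. X \<in> C \<Longrightarrow> M \<subset> X \<Longrightarrow> X \<subseteq> N \<Longrightarrow> N = X" by simp_all
    have sN: "submodule N" "N \<subseteq> B" using flagD(1,3)[OF C N(1)] .
    obtain f where "layer M B f" using layer_split[OF l MD(2,3) MB] by blast
    then obtain g where g: "layer M N g"
      using layer_split[OF _ sN(1) psubset_imp_subset[OF N(2)] sN(2)] by blast
    obtain M1 where M1: "layer M M1 1" "M1 \<subseteq> N"
      using ex_layer_1[OF g] N(2) by (metis psubset_eq)
    note M1D = layerD[OF M1(1)]
    have "M1 \<noteq> M" using M1(1) layer_same_iff by auto
    then have MM1: "M \<subset> M1" using M1D(3) by simp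
    have AM1: "A \<subset> M1" "M1 \<subseteq> B"
      using order_le_less_trans[OF MD(3) MM1] order_trans[OF M1(2) sN(2)] .
    have "\<forall>X\<in>C. X \<subseteq> M1 \<or> M1 \<subseteq> X"
    proof
      fix X assume X: "X \<in> C"
      have "X \<subseteq> M \<or> M \<subset> X"
      proof (cases "M = A")
        case True
        then show ?thesis using flagD(2)[OF C X] by simp
      next
        case False
        then show ?thesis using flag_comparable[OF C X, of M] e(3) by (auto simp: order_le_less)
      qed
      moreover have "N \<subseteq> X" if "M \<subset> X"
        using flag_comparable[OF C X N(1)] N(3)[OF X that] by auto
      ultimately show "X \<subseteq> M1 \<or> M1 \<subseteq> X" by (meson M1D(3) M1(2) order_trans)
    qed
    then have "M1 \<in> C" using flag_maximal[OF C M1D(2) AM1] by blast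
    obtain e' where e': "layer A M1 e'"
      using layer_split[OF l M1D(2) psubset_imp_subset[OF AM1(1)] AM1(2)] by blast
    then obtain f' where f': "f' \<le> e'" "layer A M f'" "layer M M1 (e' - f')"
      using layer_split[OF e' MD(2,3) M1D(3)] by blast
    then have "f' = e" "e' - f' = 1" using layer_unique e(2) M1(1) by blast+
    then have "e' \<le> i" using e(1) \<open>e \<noteq> i\<close> by simp
    then have "M1 \<in> S" using \<open>M1 \<in> C\<close> e' by (auto simp: S_def)
    then show False using M(2) M1D(3) \<open>M1 \<noteq> M\<close> by metis
  qed
  then show ?thesis using e by blast
qed

text \<open>
  The flags are classified by their member of dimension \<open>i\<close> over \<open>A\<close>, which is unique because
  comparable modules of equal index coincide.
\<close>

lemma card_flags_split:
  assumes l: "layer A B d" and i: "i \<le> d"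
  shows "card (flags A B) = (\<Sum>M | layer A M i \<and> M \<subseteq> B. card (flags A M) * card (flags M B))"
proof -
  let ?R = "{M. layer A M i \<and> M \<subseteq> B}"
  let ?F = "\<lambda>M. {C \<in> flags A B. M \<in> insert A C}"
  have fin: "finite ?R"
    by (rule finite_subset[OF _ finite_between[OF l]]) (blast dest: layerD(2,3))
  have un: "flags A B = (\<Union>M\<in>?R. ?F M)"
  proof -
    have "\<exists>M. (layer A M i \<and> M \<subseteq> B) \<and> M \<in> insert A C" if C: "C \<in> flags A B" for C
    proof -
      obtain M where "M \<in> insert A C" "layer A M i" using flag_has_rank[OF l i C] by blast
      moreover have "M \<subseteq> B" using calculation(1) C layerD(3)[OF l] by (auto simp: flags_iff interval_def)
      ultimately show ?thesis by blast
    qed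
    then show ?thesis by blast
  qed
  have disj: "?F M \<inter> ?F M' = {}" if M: "M \<in> ?R" "M' \<in> ?R" "M \<noteq> M'" for M M'
  proof -
    have *: "X = Y" if XY: "layer A X i" "layer A Y i" "X \<subseteq> Y" for X Y
    proof -
      obtain e where "layer A X e" "layer X Y (i - e)"
        using layer_split[OF XY(2) layerD(2,3)[OF XY(1)] XY(3)] by blast
      then have "layer X Y 0" using layer_unique[OF XY(1)] by auto
      then show ?thesis using layer_zero_imp_eq by blast
    qed
    have "\<not> (M \<subseteq> M' \<or> M' \<subseteq> M)" using *[of M M'] *[of M' M] M by blast
    moreover have "M \<subseteq> M' \<or> M' \<subseteq> M" if "C \<in> ?F M \<inter> ?F M'" for C
    proof -
      have C: "C \<in> flags A B" "M \<in> insert A C" "M' \<in> insert A C" using that by auto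
      show ?thesis
        using flag_comparable[OF C(1), of M M'] C(2,3) layerD(3)[of A M i] layerD(3)[of A M' i] M(1,2)
        by auto
    qed
    ultimately show ?thesis by blast
  qed
  have "card (\<Union>M\<in>?R. ?F M) = (\<Sum>M\<in>?R. card (?F M))"
  proof (rule card_UN_disjoint)
    show "\<forall>M\<in>?R. finite (?F M)" using finite_flags[OF l] by simp
    show "\<forall>M\<in>?R. \<forall>M'\<in>?R. M \<noteq> M' \<longrightarrow> ?F M \<inter> ?F M' = {}" using disj by blast
  qed (rule fin)
  then have "card (flags A B) = (\<Sum>M\<in>?R. card (?F M))" using un by argo
  also have "\<dots> = (\<Sum>M\<in>?R. card (flags A M) * card (flags M B))"
    by (intro sum.cong refl card_flags_through) (auto dest: layerD)
  finally show ?thesis .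
qed

lemma flags_empty: "flags A A = {{}}"
  by (auto simp: flags_iff interval_def)

lemma flags_layer_1:
  assumes l: "layer A B 1" shows "flags A B = {{B}}"
proof -
  have B: "B \<in> interval A B" and "interval A B \<subseteq> {B}"
    using layer_1_between[OF l] layerD[OF l] l layer_same_iff by (auto simp: interval_def)
  then have "interval A B = {B}" by blast
  then have "C \<in> flags A B \<longleftrightarrow> C = {B}" for C
    unfolding flags_iff by (cases "B \<in> C") auto
  then show ?thesis by blast
qed

text \<open>
  Classify the flags by their first member: there are \<open>(q\<^sup>d - 1) / (q - 1)\<close> lines, and the rest of the flag
  lives in dimension one less.
\<close>

lemma card_flags: "layer A B d \<Longrightarrow> card (flags A B) = flag_number d"
proof (induction d arbitrary: A)
  case 0
  then have "A = B" by (rule layer_zero_imp_eq)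
  then show ?case by (simp add: flags_empty flag_number_def)
next
  case (Suc d)
  let ?C = "{M. layer A M 1 \<and> M \<subseteq> B}"
  have "card (flags A B) = (\<Sum>M\<in>?C. card (flags A M) * card (flags M B))"
    using card_flags_split[OF Suc.prems, of 1] by simp
  also have "\<dots> = (\<Sum>M\<in>?C. flag_number d)"
  proof (rule sum.cong)
    fix M assume M: "M \<in> ?C"
    then have "layer M B d" using layer_above_cover[OF Suc.prems] by blast
    then show "card (flags A M) * card (flags M B) = flag_number d"
      using Suc.IH M flags_layer_1 by simp
  qed simp
  also have "\<dots> = card ?C * flag_number d" by simp
  also have "card ?C = (q ^ Suc d - 1) div (q - 1)"
    using card_covers[OF Suc.prems] one_less_q by (metis nonzero_mult_div_cancel_right zero_less_diff less_numeral_extra(3))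
  finally show ?case by (simp add: flag_number_def)
qed

section \<open>Lattices\<close>

lemma free_basisD:
  assumes "free_basis B L"
  shows "finite B" "B \<subseteq> L"
    and free_basis_expand: "\<And>x. x \<in> L \<Longrightarrow> \<exists>c. (\<forall>b\<in>B. c b \<in> \<O>) \<and> x = (\<Sum>b\<in>B. c b *s b)"
    and free_basis_unique: "\<And>c b. \<forall>b\<in>B. c b \<in> \<O> \<Longrightarrow> (\<Sum>b\<in>B. c b *s b) = 0 \<Longrightarrow> b \<in> B \<Longrightarrow> c b = 0"
  using assms unfolding free_basis_def by blast+

lemma lattice_submodule: "is_lattice L \<Longrightarrow> submodule L"
  by (simp add: is_lattice_def)

lemma lattice_dilate:
  assumes "is_lattice L" "\<alpha> \<noteq> 0" shows "is_lattice (dilate \<alpha> L)"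
proof -
  obtain B where B: "free_basis B L" "card B = m" using assms by (auto simp: is_lattice_def)
  note BD = free_basisD[OF B(1)]
  have inj: "inj_on (\<lambda>x. \<alpha> *s x) B"
    using injective_scale[OF assms(2)] by (rule inj_on_subset) simp
  have sum: "(\<Sum>b\<in>dilate \<alpha> B. c b *s b) = \<alpha> *s (\<Sum>b\<in>B. c (\<alpha> *s b) *s b)" for c
    by (simp add: sum.reindex[OF inj] scale_sum_right mult.commute)
  have "free_basis (dilate \<alpha> B) (dilate \<alpha> L)"
    unfolding free_basis_def
  proof (intro conjI ballI allI impI)
    show "finite (dilate \<alpha> B)" "dilate \<alpha> B \<subseteq> dilate \<alpha> L" using BD(1,2) by auto
    fix x assume "x \<in> dilate \<alpha> L"
    then obtain y where y: "y \<in> L" "x = \<alpha> *s y" by auto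
    then obtain c where c: "\<forall>b\<in>B. c b \<in> \<O>" "y = (\<Sum>b\<in>B. c b *s b)" using BD(3) by blast
    define d where "d b = c (inverse \<alpha> *s b)" for b
    have d: "d (\<alpha> *s b) = c b" for b using assms(2) by (simp add: d_def)
    then have "x = (\<Sum>b\<in>dilate \<alpha> B. d b *s b)" unfolding sum y(2) c(2) by simp
    moreover have "\<forall>b\<in>dilate \<alpha> B. d b \<in> \<O>" using c(1) d by simp
    ultimately show "\<exists>c. (\<forall>b\<in>dilate \<alpha> B. c b \<in> \<O>) \<and> x = (\<Sum>b\<in>dilate \<alpha> B. c b *s b)"
      by blast
  next
    fix c b assume c: "(\<forall>b\<in>dilate \<alpha> B. c b \<in> \<O>) \<and> (\<Sum>b\<in>dilate \<alpha> B. c b *s b) = 0"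
      and b: "b \<in> dilate \<alpha> B"
    have "\<alpha> *s (\<Sum>b\<in>B. c (\<alpha> *s b) *s b) = 0" using c sum by metis
    then have "(\<Sum>b\<in>B. c (\<alpha> *s b) *s b) = 0" using assms(2) by simp
    moreover have "\<forall>b\<in>B. c (\<alpha> *s b) \<in> \<O>" using conjunct1[OF c] by blast
    ultimately have "\<forall>b\<in>B. c (\<alpha> *s b) = 0" using BD(4)[of "\<lambda>b. c (\<alpha> *s b)"] by blast
    then show "c b = 0" using b by blast
  qed
  moreover have "card (dilate \<alpha> B) = m" using card_image[OF inj] B by simp
  ultimately show ?thesis using assms submodule_dilate by (auto simp: is_lattice_def)
qed

text \<open>
  In coordinates with respect to a free basis, reduction modulo \<open>\<pi>\<close> is reduction of each of the \<open>m\<close>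
  coordinates.
\<close>

lemma layer_lattice:
  assumes "is_lattice L" shows "layer (dilate \<pi> L) L m"
proof -
  obtain B where B: "free_basis B L" "card B = m" using assms by (auto simp: is_lattice_def)
  note BD = free_basisD[OF B(1)]
  note L = lattice_submodule[OF assms]
  obtain T where T: "finite T" "card T = q" "T \<subseteq> \<O>"
    "\<And>c. c \<in> \<O> \<Longrightarrow> \<exists>u\<in>T. (c - u) / \<pi> \<in> \<O>"
    "\<And>u v. u \<in> T \<Longrightarrow> v \<in> T \<Longrightarrow> (u - v) / \<pi> \<in> \<O> \<Longrightarrow> u = v"
    using residue_representatives by metis
  have comb: "(\<Sum>b\<in>B. c b *s b) \<in> L" if "\<forall>b\<in>B. c b \<in> \<O>" for c
    using that BD(2) submoduleD(4)[OF L] by (intro submodule_sum[OF L]) blast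
  define f where "f c = coset (dilate \<pi> L) (\<Sum>b\<in>B. c b *s b)" for c
  have \<pi>L: "submodule (dilate \<pi> L)" using submodule_dilate[OF L] .
  have "bij_betw f (PiE B (\<lambda>_. T)) (quot L (dilate \<pi> L))"
    unfolding bij_betw_def
  proof
    show "inj_on f (PiE B (\<lambda>_. T))"
    proof (rule inj_onI)
      fix c d assume cd: "c \<in> PiE B (\<lambda>_. T)" "d \<in> PiE B (\<lambda>_. T)" "f c = f d"
      then have "(\<Sum>b\<in>B. c b *s b) - (\<Sum>b\<in>B. d b *s b) \<in> dilate \<pi> L"
        by (simp add: f_def coset_eq_iff[OF \<pi>L])
      then obtain y where y: "y \<in> L" "(\<Sum>b\<in>B. c b *s b) - (\<Sum>b\<in>B. d b *s b) = \<pi> *s y" by auto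
      obtain e where e: "\<forall>b\<in>B. e b \<in> \<O>" "y = (\<Sum>b\<in>B. e b *s b)" using BD(3)[OF y(1)] by blast
      have "(\<Sum>b\<in>B. (c b - d b - \<pi> * e b) *s b) = 0"
        using y(2) e(2)
        by (simp add: scale_left_diff_distrib sum_subtractf scale_sum_right)
      moreover have "\<forall>b\<in>B. c b - d b - \<pi> * e b \<in> \<O>"
        using cd(1,2) e(1) T(3) by (intro ballI integers_diff integers_mult) auto
      ultimately have "c b - d b - \<pi> * e b = 0" if "b \<in> B" for b
        using BD(4)[of "\<lambda>b. c b - d b - \<pi> * e b"] that by blast
      then have "(c b - d b) / \<pi> \<in> \<O>" if "b \<in> B" for b using that e(1) uniformizer by simp
      then have "c b = d b" if "b \<in> B" for b
        using that T(5)[of "c b" "d b"] cd(1,2) by blast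
      then show "c = d" using cd(1,2) by (intro PiE_ext) auto
    qed
    show "f ` (PiE B (\<lambda>_. T)) = quot L (dilate \<pi> L)"
    proof
      show "f ` (PiE B (\<lambda>_. T)) \<subseteq> quot L (dilate \<pi> L)"
      proof
        fix X assume "X \<in> f ` (PiE B (\<lambda>_. T))"
        then obtain c where c: "c \<in> PiE B (\<lambda>_. T)" "X = f c" by auto
        then have "(\<Sum>b\<in>B. c b *s b) \<in> L" using T(3) by (intro comb) auto
        then show "X \<in> quot L (dilate \<pi> L)" using c by (simp add: quot_def f_def)
      qed
      show "quot L (dilate \<pi> L) \<subseteq> f ` (PiE B (\<lambda>_. T))"
      proof
        fix X assume "X \<in> quot L (dilate \<pi> L)"
        then obtain x where x: "X = coset (dilate \<pi> L) x" "x \<in> L" by (auto simp: quot_def)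
        obtain c where c: "\<forall>b\<in>B. c b \<in> \<O>" "x = (\<Sum>b\<in>B. c b *s b)" using BD(3)[OF x(2)] by blast
        then have "\<forall>b\<in>B. \<exists>u. u \<in> T \<and> (c b - u) / \<pi> \<in> \<O>" using T(4) by blast
        then obtain u where u: "\<forall>b\<in>B. u b \<in> T \<and> (c b - u b) / \<pi> \<in> \<O>" by metis
        have "x - (\<Sum>b\<in>B. u b *s b) = \<pi> *s (\<Sum>b\<in>B. ((c b - u b) / \<pi>) *s b)"
          using uniformizer by (simp add: c(2) scale_sum_right sum_subtractf scale_left_diff_distrib)
        moreover have "(\<Sum>b\<in>B. ((c b - u b) / \<pi>) *s b) \<in> L" using u by (intro comb) simp
        ultimately have "x - (\<Sum>b\<in>B. u b *s b) \<in> dilate \<pi> L" by (rule image_eqI)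
        then have "X = f (restrict u B)"
          by (simp add: x(1) f_def coset_eq_iff[OF \<pi>L])
        moreover have "restrict u B \<in> PiE B (\<lambda>_. T)" using u by auto
        ultimately show "X \<in> f ` (PiE B (\<lambda>_. T))" by blast
      qed
    qed
  qed
  then have "card (quot L (dilate \<pi> L)) = card (PiE B (\<lambda>_. T))"
    by (simp add: bij_betw_same_card)
  also have "\<dots> = q ^ m" using BD(1) T(2) B(2) by (simp add: card_PiE)
  finally show ?thesis
    using L \<pi>L dilate_integral_subset[OF L] by (simp add: layer_def)
qed

text \<open>
  Exchange argument: some coefficient of \<open>\<pi> x\<close> with respect to a basis of \<open>A\<close> is a unit, since otherwise
  dividing by \<open>\<pi>\<close> would give \<open>x \<in> A\<close>.  The corresponding basis vector can be replaced by \<open>x\<close>.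
\<close>

lemma lattice_adjoin:
  assumes "is_lattice A" and x: "x \<in> V" "x \<notin> A" "\<pi> *s x \<in> A"
  shows "is_lattice (adjoin A x)"
proof -
  obtain B where B: "free_basis B A" "card B = m" using assms by (auto simp: is_lattice_def)
  note BD = free_basisD[OF B(1)] and A = lattice_submodule[OF assms(1)]
  obtain c where c: "\<forall>b\<in>B. c b \<in> \<O>" "\<pi> *s x = (\<Sum>b\<in>B. c b *s b)" using BD(3)[OF x(3)] by blast
  have "\<exists>b\<in>B. c b / \<pi> \<notin> \<O>"
  proof (rule ccontr)
    assume "\<not> (\<exists>b\<in>B. c b / \<pi> \<notin> \<O>)"
    then have "(\<Sum>b\<in>B. (c b / \<pi>) *s b) \<in> A"
      using BD(2) submoduleD(4)[OF A] by (intro submodule_sum[OF A]) blast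
    moreover have "\<pi> *s (\<Sum>b\<in>B. (c b / \<pi>) *s b) = \<pi> *s x"
      unfolding c(2) scale_sum_right using uniformizer by simp
    ultimately show False using x(2) uniformizer by simp
  qed
  then obtain e where e: "e \<in> B" "c e / \<pi> \<notin> \<O>" by blast
  then have ce: "c e \<noteq> 0" "inverse (c e) \<in> \<O>"
    using c(1) by (auto elim: divide_uniformizer_cases)
  define R where "R = B - {e}"
  have R: "finite R" "e \<notin> R" "B = insert e R" "x \<notin> R"
    using e BD(1,2) x(2) by (auto simp: R_def)
  have \<pi>x: "\<pi> *s x = c e *s e + (\<Sum>b\<in>R. c b *s b)" using R c(2) by simp
  have "free_basis (insert x R) (adjoin A x)"
    unfolding free_basis_def
  proof (intro conjI ballI allI impI)
    show "finite (insert x R)" using R by simp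
    show "insert x R \<subseteq> adjoin A x"
      using adjoin_mem[OF A] adjoin_superset[of A x] BD(2) R(3) by blast
  next
    fix y assume "y \<in> adjoin A x"
    then obtain a d where y: "y = a + d *s x" "a \<in> A" "d \<in> \<O>" by (auto simp: adjoin_def)
    then obtain g where g: "\<forall>b\<in>B. g b \<in> \<O>" "a = (\<Sum>b\<in>B. g b *s b)" using BD(3) by blast
    \<comment> \<open>Eliminates the basis vector \<open>e\<close> in favour of \<open>x\<close>: \<open>t\<close> is the multiple of \<open>\<pi> x\<close> with \<open>e\<close>-coefficient \<open>g e\<close>.\<close>
    define t where "t = g e * inverse (c e)"
    have t: "t \<in> \<O>" using g e ce by (auto simp: t_def intro: integers_mult)
    define h where "h b = (if b = x then d + t * \<pi> else g b - t * c b)" for b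
    have "t *s (\<pi> *s x) = g e *s e + (\<Sum>b\<in>R. (t * c b) *s b)"
      unfolding \<pi>x by (simp add: scale_right_distrib scale_sum_right t_def ce)
    then have ge: "g e *s e = (t * \<pi>) *s x - (\<Sum>b\<in>R. (t * c b) *s b)" by simp
    have "(\<Sum>b\<in>R. h b *s b) = (\<Sum>b\<in>R. g b *s b) - (\<Sum>b\<in>R. (t * c b) *s b)"
      unfolding sum_subtractf[symmetric]
      by (rule sum.cong) (use R(4) in \<open>auto simp: h_def scale_left_diff_distrib\<close>)
    then have "y = (\<Sum>b\<in>insert x R. h b *s b)"
      using R g(2) by (simp add: y(1) ge h_def[of x] scale_left_distrib)
    moreover have "\<forall>b\<in>insert x R. h b \<in> \<O>"
      using g(1) c(1) t y(3) R(3) by (auto simp: h_def intro!: integers_add integers_diff integers_mult)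
    ultimately show "\<exists>h. (\<forall>b\<in>insert x R. h b \<in> \<O>) \<and> y = (\<Sum>b\<in>insert x R. h b *s b)" by blast
  next
    fix h b assume h: "(\<forall>b\<in>insert x R. h b \<in> \<O>) \<and> (\<Sum>b\<in>insert x R. h b *s b) = 0"
      and b: "b \<in> insert x R"
    \<comment> \<open>The coefficients of \<open>\<pi>\<close> times the given relation, after \<open>\<pi> x\<close> has been expanded in \<open>B\<close>.\<close>
    define k where "k b = (if b = e then h x * c e else \<pi> * h b + h x * c b)" for b
    have "(\<Sum>b\<in>B. k b *s b) = (h x * c e) *s e + (\<Sum>b\<in>R. (\<pi> * h b + h x * c b) *s b)"
    proof -
      have "(\<Sum>b\<in>R. k b *s b) = (\<Sum>b\<in>R. (\<pi> * h b + h x * c b) *s b)"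
        by (rule sum.cong) (use R(2) in \<open>auto simp: k_def\<close>)
      then show ?thesis using R by (simp add: k_def[of e])
    qed
    also have "\<dots> = h x *s (\<pi> *s x) + \<pi> *s (\<Sum>b\<in>R. h b *s b)"
      unfolding \<pi>x by (simp add: scale_left_distrib scale_right_distrib sum.distrib scale_sum_right)
    also have "\<dots> = \<pi> *s (\<Sum>b\<in>insert x R. h b *s b)"
      using R by (simp add: scale_right_distrib mult.commute)
    also have "\<dots> = 0" using h by simp
    finally have "(\<Sum>b\<in>B. k b *s b) = 0" .
    moreover have "\<forall>b\<in>B. k b \<in> \<O>"
      using h c(1) R(3) by (auto simp: k_def intro!: integers_add integers_mult)
    ultimately have k: "k b = 0" if "b \<in> B" for b using BD(4) that by blast
    have "h x = 0" using k[OF e(1)] ce by (simp add: k_def)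
    moreover have "h b = 0" if "b \<in> R" for b
    proof -
      have "b \<noteq> e" "b \<in> B" using that R by auto
      then show ?thesis using k[of b] \<open>h x = 0\<close> uniformizer by (simp add: k_def)
    qed
    ultimately show "h b = 0" using b by blast
  qed
  moreover have "card (insert x R) = m" using R B(2) by simp
  ultimately show ?thesis using submodule_adjoin[OF A x(1)] by (auto simp: is_lattice_def)
qed

text \<open>
  There are finitely many modules between \<open>\<pi> L\<close> and \<open>L\<close>, so a maximal lattice inside \<open>M\<close> exists; it is \<open>M\<close>,
  since elements of \<open>M\<close> can be adjoined to a lattice.
\<close>

lemma lattice_between:
  assumes L: "is_lattice L" and M: "submodule M" "dilate \<pi> L \<subseteq> M" "M \<subseteq> L"
  shows "is_lattice M"
proof -
  define S where "S = {N. is_lattice N \<and> dilate \<pi> L \<subseteq> N \<and> N \<subseteq> M}"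
  have "S \<subseteq> {N. submodule N \<and> dilate \<pi> L \<subseteq> N \<and> N \<subseteq> L}"
    using M(3) lattice_submodule by (auto simp: S_def)
  then have "finite S" using finite_between[OF layer_lattice[OF L]] by (rule finite_subset)
  moreover have "dilate \<pi> L \<in> S" using lattice_dilate[OF L] uniformizer M by (simp add: S_def)
  ultimately obtain N where N: "N \<in> S" "\<forall>X\<in>S. N \<subseteq> X \<longrightarrow> N = X"
    using finite_has_maximal2[of S "dilate \<pi> L"] by blast
  have "M \<subseteq> N"
  proof
    fix x assume x: "x \<in> M"
    show "x \<in> N"
    proof (rule ccontr)
      assume xN: "x \<notin> N"
      have "dilate \<pi> L \<subseteq> N" using N(1) by (simp add: S_def)
      then have "x \<in> V" "\<pi> *s x \<in> N"
        using x M(3) submoduleD(1)[OF M(1)] by auto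
      then have "is_lattice (adjoin N x)"
        using N(1) xN by (intro lattice_adjoin) (auto simp: S_def)
      moreover have "adjoin N x \<subseteq> M" by (rule adjoin_least) (use N(1) x M(1) in \<open>auto simp: S_def\<close>)
      ultimately have "adjoin N x \<in> S"
        using N(1) adjoin_superset[of N x] by (auto simp: S_def)
      then have "N = adjoin N x" using N(2) adjoin_superset by blast
      moreover have "x \<in> adjoin N x" using N(1) lattice_submodule by (intro adjoin_mem) (auto simp: S_def)
      ultimately show False using xN by blast
    qed
  qed
  then show ?thesis using N(1) by (auto simp: S_def)
qed

section \<open>The chambers containing a vertex\<close>

definition cls :: "'v set \<Rightarrow> 'v set set" where
  "cls L = homothetic `` {L}"

lemma mem_cls_iff: "L' \<in> cls L \<longleftrightarrow> is_lattice L \<and> (\<exists>\<alpha>. \<alpha> \<noteq> 0 \<and> L' = dilate \<alpha> L)"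
  using lattice_dilate by (auto simp: cls_def homothetic_def)

lemma vertices_eq: "vertices = cls ` {L. is_lattice L}"
  by (auto simp: vertices_def quotient_def cls_def)

lemma cls_dilate:
  assumes "is_lattice L" "\<alpha> \<noteq> 0" shows "cls (dilate \<alpha> L) = cls L"
proof (rule set_eqI)
  fix X
  have "(\<exists>\<beta>. \<beta> \<noteq> 0 \<and> X = dilate \<beta> (dilate \<alpha> L)) \<longleftrightarrow> (\<exists>\<beta>. \<beta> \<noteq> 0 \<and> X = dilate \<beta> L)"
  proof
    assume "\<exists>\<beta>. \<beta> \<noteq> 0 \<and> X = dilate \<beta> (dilate \<alpha> L)"
    then obtain \<beta> where "\<beta> \<noteq> 0" "X = dilate (\<beta> * \<alpha>) L" by (auto simp: dilate_dilate)
    then show "\<exists>\<beta>. \<beta> \<noteq> 0 \<and> X = dilate \<beta> L" using assms(2) by (intro exI[of _ "\<beta> * \<alpha>"]) simp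
  next
    assume "\<exists>\<beta>. \<beta> \<noteq> 0 \<and> X = dilate \<beta> L"
    then obtain \<beta> where "\<beta> \<noteq> 0" "X = dilate \<beta> L" by auto
    then show "\<exists>\<beta>. \<beta> \<noteq> 0 \<and> X = dilate \<beta> (dilate \<alpha> L)"
      using assms(2) by (intro exI[of _ "\<beta> / \<alpha>"]) (simp add: dilate_dilate)
  qed
  then show "X \<in> cls (dilate \<alpha> L) \<longleftrightarrow> X \<in> cls L"
    using assms lattice_dilate by (simp add: mem_cls_iff)
qed

lemma cls_eqD:
  assumes "is_lattice L" "cls L = cls L'" obtains \<alpha> where "\<alpha> \<noteq> 0" "L = dilate \<alpha> L'"
proof -
  have "L \<in> cls L" using assms(1) dilate_one[of L] unfolding mem_cls_iff by (metis zero_neq_one)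
  then show thesis using assms(2) that by (auto simp: mem_cls_iff)
qed

lemma dilate_commute: "dilate \<alpha> (dilate \<beta> L) = dilate \<beta> (dilate \<alpha> L)"
  by (simp only: dilate_dilate mult.commute)

text \<open>
  Only the representative of the second vertex needs to be varied, because scaling both lattices
  by the same factor preserves the inclusions.
\<close>

lemma incident_cls_iff:
  assumes "is_lattice L" "is_lattice M"
  shows "incident (cls L) (cls M) \<longleftrightarrow> (\<exists>\<delta>. \<delta> \<noteq> 0 \<and> dilate \<pi> L \<subseteq> dilate \<delta> M \<and> dilate \<delta> M \<subseteq> L)"
proof
  assume "incident (cls L) (cls M)"
  then obtain \<beta> \<gamma> where *: "\<beta> \<noteq> 0" "\<gamma> \<noteq> 0"
    "dilate \<pi> (dilate \<beta> L) \<subseteq> dilate \<gamma> M" "dilate \<gamma> M \<subseteq> dilate \<beta> L"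
    unfolding incident_def Bex_def mem_cls_iff by metis
  have "dilate \<gamma> M = dilate \<beta> (dilate (\<gamma> / \<beta>) M)" using *(1) by (simp add: dilate_dilate)
  then have "dilate \<beta> (dilate \<pi> L) \<subseteq> dilate \<beta> (dilate (\<gamma> / \<beta>) M)"
    "dilate \<beta> (dilate (\<gamma> / \<beta>) M) \<subseteq> dilate \<beta> L"
    using *(3,4) dilate_commute[of \<pi> \<beta> L] by simp_all
  then have "dilate \<pi> L \<subseteq> dilate (\<gamma> / \<beta>) M" "dilate (\<gamma> / \<beta>) M \<subseteq> L"
    unfolding dilate_subset_iff[OF *(1)] .
  moreover have "\<gamma> / \<beta> \<noteq> 0" using * by simp
  ultimately show "\<exists>\<delta>. \<delta> \<noteq> 0 \<and> dilate \<pi> L \<subseteq> dilate \<delta> M \<and> dilate \<delta> M \<subseteq> L" by blast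
next
  assume "\<exists>\<delta>. \<delta> \<noteq> 0 \<and> dilate \<pi> L \<subseteq> dilate \<delta> M \<and> dilate \<delta> M \<subseteq> L"
  moreover have "L \<in> cls L" using assms(1) dilate_one[of L] unfolding mem_cls_iff by (metis zero_neq_one)
  ultimately show "incident (cls L) (cls M)"
    using assms(2) unfolding incident_def Bex_def mem_cls_iff by metis
qed

lemma dilate_uniformizer_psubset:
  assumes "is_lattice L" shows "dilate \<pi> L \<subset> L"
  using layer_lattice[OF assms] layer_same_iff m_pos layerD(3) by (metis neq0_conv psubsetI)

lemma lattice_interval: "is_lattice L \<Longrightarrow> M \<in> interval (dilate \<pi> L) L \<Longrightarrow> is_lattice M"
  by (rule lattice_between) (auto simp: interval_def)

lemma top_in_interval: "is_lattice L \<Longrightarrow> L \<in> interval (dilate \<pi> L) L"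
  by (simp add: interval_def lattice_submodule dilate_uniformizer_psubset)

lemma normalized_representative:
  assumes L: "is_lattice L" and t: "t \<in> vertices" "t \<noteq> cls L \<Longrightarrow> incident (cls L) t"
  obtains M where "M \<in> interval (dilate \<pi> L) L" "t = cls M"
proof (cases "t = cls L")
  case True
  then show ?thesis using that top_in_interval[OF L] by blast
next
  case False
  obtain N where N: "is_lattice N" "t = cls N" using t(1) by (auto simp: vertices_eq)
  then obtain \<delta> where \<delta>: "\<delta> \<noteq> 0" "dilate \<pi> L \<subseteq> dilate \<delta> N" "dilate \<delta> N \<subseteq> L"
    using t(2)[OF False] incident_cls_iff[OF L N(1)] by blast
  have t': "t = cls (dilate \<delta> N)" using N \<delta>(1) cls_dilate by simp
  then have "dilate \<delta> N \<noteq> dilate \<pi> L" using False cls_dilate[OF L uniformizer(1)] by auto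
  then have "dilate \<delta> N \<in> interval (dilate \<pi> L) L"
    using \<delta> submodule_dilate[OF lattice_submodule[OF N(1)]] by (auto simp: interval_def)
  then show ?thesis using that t' by blast
qed

lemma interval_not_below:
  "M \<in> interval (dilate \<pi> L) L \<Longrightarrow> \<not> M \<subseteq> dilate \<pi> L"
  by (auto simp: interval_def)

text \<open>
  Elements of the interval are not contained in \<open>\<pi> L\<close>, and this excludes scaling by factors of
  negative valuation.
\<close>

lemma interval_dilate_cases:
  assumes "M \<in> interval (dilate \<pi> L) L" "submodule N" "N \<subseteq> L" "\<delta> \<noteq> 0" "dilate \<delta> M \<subseteq> N"
  obtains "dilate \<delta> M \<subseteq> dilate \<pi> M" | "dilate \<delta> M = M"
proof -
  have M: "submodule M" using assms(1) by (simp add: interval_def)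
  have "\<not> M \<subseteq> dilate \<pi> N"
    using interval_not_below[OF assms(1)] dilate_subset_iff[OF uniformizer(1), of N L] assms(3)
    by (meson order_trans)
  then show thesis
    using dilate_trichotomy[OF M assms(4)] assms(2,5) that by metis
qed

lemma inj_on_cls:
  assumes L: "is_lattice L" shows "inj_on cls (interval (dilate \<pi> L) L)"
proof (rule inj_onI)
  fix M N assume MN: "M \<in> interval (dilate \<pi> L) L" "N \<in> interval (dilate \<pi> L) L" "cls M = cls N"
  then obtain \<alpha> where \<alpha>: "\<alpha> \<noteq> 0" "M = dilate \<alpha> N"
    using cls_eqD[OF lattice_interval[OF L MN(1)]] by metis
  have sub: "submodule M" "M \<subseteq> L" "dilate \<alpha> N \<subseteq> M" using MN(1) \<alpha>(2) by (auto simp: interval_def)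
  show "M = N"
  proof (cases rule: interval_dilate_cases[OF MN(2) sub(1,2) \<alpha>(1) sub(3)])
    case 1
    then have "M \<subseteq> dilate \<pi> N" using \<alpha>(2) by simp
    moreover have "dilate \<pi> N \<subseteq> dilate \<pi> L"
      using MN(2) dilate_subset_iff[OF uniformizer(1), of N L] by (simp add: interval_def)
    ultimately show ?thesis using interval_not_below[OF MN(1)] by auto
  next
    case 2
    then show ?thesis using \<alpha>(2) by simp
  qed
qed

text \<open>
  Incidence provides \<open>\<pi> M \<subseteq> \<delta> N \<subseteq> M\<close>.  If \<open>\<delta>\<close> is a unit, then \<open>N \<subseteq> M\<close>; if its valuation is positive, then
  \<open>\<pi> M \<subseteq> \<pi> N\<close>.  Conversely \<open>\<pi> M \<subseteq> \<pi> L \<subseteq> N\<close> holds for any two members of the interval.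
\<close>

lemma incident_interval_iff:
  assumes L: "is_lattice L" and M: "M \<in> interval (dilate \<pi> L) L" and N: "N \<in> interval (dilate \<pi> L) L"
  shows "incident (cls M) (cls N) \<longleftrightarrow> M \<subseteq> N \<or> N \<subseteq> M"
proof
  note lat = lattice_interval[OF L M] lattice_interval[OF L N]
  have sub: "submodule M" "M \<subseteq> L" using M by (auto simp: interval_def)
  assume "incident (cls M) (cls N)"
  then obtain \<delta> where \<delta>: "\<delta> \<noteq> 0" "dilate \<pi> M \<subseteq> dilate \<delta> N" "dilate \<delta> N \<subseteq> M"
    using incident_cls_iff lat by blast
  then show "M \<subseteq> N \<or> N \<subseteq> M"
  proof (cases rule: interval_dilate_cases[OF N sub \<delta>(1,3)])
    case 1
    then have "dilate \<pi> M \<subseteq> dilate \<pi> N" using \<delta>(2) by (meson order_trans)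
    then show ?thesis using dilate_subset_iff[OF uniformizer(1)] by simp
  next
    case 2
    then show ?thesis using \<delta>(3) by simp
  qed
next
  note lat = lattice_interval[OF L M] lattice_interval[OF L N]
  have sub: "dilate \<pi> L \<subseteq> M" "M \<subseteq> L" "dilate \<pi> L \<subseteq> N" "N \<subseteq> L" using M N by (auto simp: interval_def)
  have \<pi>: "dilate \<pi> M \<subseteq> dilate \<pi> L" "dilate \<pi> N \<subseteq> dilate \<pi> L"
    using sub dilate_subset_iff[OF uniformizer(1)] by auto
  assume "M \<subseteq> N \<or> N \<subseteq> M"
  then show "incident (cls M) (cls N)"
  proof
    assume "M \<subseteq> N"
    then have "dilate \<pi> M \<subseteq> dilate \<pi> N" using dilate_subset_iff[OF uniformizer(1)] by simp
    moreover have "dilate \<pi> N \<subseteq> M" using \<pi>(2) sub(1) by (rule order_trans)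
    ultimately have "dilate \<pi> M \<subseteq> dilate \<pi> N" "dilate \<pi> N \<subseteq> M" .
    then show ?thesis unfolding incident_cls_iff[OF lat] using uniformizer(1) by blast
  next
    assume "N \<subseteq> M"
    moreover have "dilate \<pi> M \<subseteq> N" using \<pi>(1) sub(3) by (rule order_trans)
    ultimately have "dilate \<pi> M \<subseteq> dilate 1 N \<and> dilate 1 N \<subseteq> M"
      unfolding dilate_one by (rule conjI[rotated])
    then show ?thesis unfolding incident_cls_iff[OF lat] by (metis zero_neq_one)
  qed
qed

lemma simplex_through_iff:
  assumes L: "is_lattice L"
  shows "simplex S \<and> cls L \<in> S \<longleftrightarrow>
    (\<exists>D \<subseteq> interval (dilate \<pi> L) L. S = cls ` D \<and> L \<in> D \<and> (\<forall>X\<in>D. \<forall>Y\<in>D. X \<subseteq> Y \<or> Y \<subseteq> X))"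
    (is "_ \<longleftrightarrow> ?chain")
proof
  let ?I = "interval (dilate \<pi> L) L"
  assume S: "simplex S \<and> cls L \<in> S"
  have inc: "incident s t" if "s \<in> S" "t \<in> S" "s \<noteq> t" for s t
    using S that by (auto simp: simplex_def pairwise_def)
  let ?D = "{M \<in> ?I. cls M \<in> S}"
  have "t \<in> cls ` ?D" if "t \<in> S" for t
  proof -
    have "t \<in> vertices" using S that by (auto simp: simplex_def)
    moreover have "incident (cls L) t" if "t \<noteq> cls L" using that inc[of "cls L" t] S \<open>t \<in> S\<close> by blast
    ultimately obtain M where "M \<in> ?I" "t = cls M" using normalized_representative[OF L] by blast
    then show ?thesis using that by blast
  qed
  moreover have "X \<subseteq> Y \<or> Y \<subseteq> X" if "X \<in> ?D" "Y \<in> ?D" for X Y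
  proof (cases "cls X = cls Y")
    case True
    then show ?thesis using inj_onD[OF inj_on_cls[OF L], of X Y] that by simp
  next
    case False
    then have "incident (cls X) (cls Y)" using inc that by simp
    then show ?thesis using incident_interval_iff[OF L] that by simp
  qed
  moreover have "L \<in> ?D" using S top_in_interval[OF L] by simp
  ultimately show ?chain by (intro exI[of _ ?D]) blast
next
  assume ?chain
  then obtain D where D: "D \<subseteq> interval (dilate \<pi> L) L" "S = cls ` D" "L \<in> D"
    "\<forall>X\<in>D. \<forall>Y\<in>D. X \<subseteq> Y \<or> Y \<subseteq> X" by blast
  have "finite S" using D(1,2) finite_interval[OF layer_lattice[OF L]] finite_subset by blast
  moreover have "S \<subseteq> vertices" using D(1,2) lattice_interval[OF L] by (auto simp: vertices_eq)
  moreover have "pairwise incident S"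
  proof (rule pairwiseI)
    fix s t assume "s \<in> S" "t \<in> S"
    then obtain X Y where XY: "X \<in> D" "Y \<in> D" "s = cls X" "t = cls Y" using D(2) by auto
    then show "incident s t"
      using incident_interval_iff[OF L subsetD[OF D(1) XY(1)] subsetD[OF D(1) XY(2)]] D(4) by simp
  qed
  ultimately show "simplex S \<and> cls L \<in> S" using D(2,3) by (simp add: simplex_def)
qed

lemma chambers_through:
  assumes L: "is_lattice L"
  shows "{C. chamber C \<and> cls L \<in> C} = (`) cls ` flags (dilate \<pi> L) L"
proof (intro subset_antisym subsetI)
  let ?I = "interval (dilate \<pi> L) L"
  fix C assume "C \<in> {C. chamber C \<and> cls L \<in> C}"
  then have C: "simplex C \<and> cls L \<in> C" and max: "\<And>S. simplex S \<Longrightarrow> C \<subseteq> S \<Longrightarrow> S = C"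
    by (auto simp: chamber_def)
  obtain D where D: "D \<subseteq> ?I" "C = cls ` D" "L \<in> D" "\<forall>X\<in>D. \<forall>Y\<in>D. X \<subseteq> Y \<or> Y \<subseteq> X"
    using C unfolding simplex_through_iff[OF L] by blast
  have "N \<in> D" if N: "N \<in> ?I" "\<forall>X\<in>D. X \<subseteq> N \<or> N \<subseteq> X" for N
  proof -
    have "insert N D \<subseteq> ?I" using D(1) N(1) by simp
    moreover have "\<forall>X\<in>insert N D. \<forall>Y\<in>insert N D. X \<subseteq> Y \<or> Y \<subseteq> X"
      unfolding ball_simps using D(4) N(2) by (metis order_refl)
    ultimately have "simplex (cls ` insert N D)"
      using simplex_through_iff[OF L, of "cls ` insert N D"] D(3) by blast
    then have "cls ` insert N D = C" by (rule max) (auto simp: D(2))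
    then have "cls N \<in> cls ` D" using D(2) by blast
    then show "N \<in> D" using inj_on_image_mem_iff[OF inj_on_cls[OF L] N(1) D(1)] by simp
  qed
  then have "D \<in> flags (dilate \<pi> L) L" using D by (simp add: flags_iff)
  then show "C \<in> (`) cls ` flags (dilate \<pi> L) L" using D(2) by blast
next
  let ?I = "interval (dilate \<pi> L) L"
  fix C assume "C \<in> (`) cls ` flags (dilate \<pi> L) L"
  then obtain D where D: "D \<in> flags (dilate \<pi> L) L" "C = cls ` D" by blast
  have LD: "L \<in> D" using top_in_flag[OF D(1) lattice_submodule dilate_uniformizer_psubset] L by blast
  have C: "simplex C \<and> cls L \<in> C"
    unfolding simplex_through_iff[OF L] using D LD by (auto simp: flags_iff)
  have "S = C" if S: "simplex S" "C \<subseteq> S" for S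
  proof -
    have "cls L \<in> S" using S C by auto
    then obtain E where E: "E \<subseteq> ?I" "S = cls ` E" "\<forall>X\<in>E. \<forall>Y\<in>E. X \<subseteq> Y \<or> Y \<subseteq> X"
      using S simplex_through_iff[OF L, of S] by blast
    have DI: "D \<subseteq> ?I" using D(1) by (simp add: flags_iff)
    have DE: "D \<subseteq> E"
    proof
      fix X assume X: "X \<in> D"
      then have "cls X \<in> cls ` E" using S(2) E(2) D(2) by blast
      then show "X \<in> E" using inj_on_image_mem_iff[OF inj_on_cls[OF L] subsetD[OF DI X] E(1)] by simp
    qed
    have "N \<in> D" if "N \<in> E" for N
    proof (rule flag_maximal[OF D(1)])
      show "submodule N" "dilate \<pi> L \<subset> N" "N \<subseteq> L"
        using subsetD[OF E(1) that] by (simp_all add: interval_def)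
      show "\<forall>X\<in>D. X \<subseteq> N \<or> N \<subseteq> X" using E(3) DE that by (meson subsetD)
    qed
    then show "S = C" using DE E(2) D(2) by blast
  qed
  then show "C \<in> {C. chamber C \<and> cls L \<in> C}" using C by (simp add: chamber_def)
qed

text \<open>
  For \<open>m = 1\<close> the convention for \<open>r\<close> agrees with \<open>flag_number 1 = 1\<close>.
\<close>

lemma card_chambers_through:
  assumes t: "t \<in> vertices" shows "r t = flag_number m"
proof -
  obtain L where L: "is_lattice L" "t = cls L" using t by (auto simp: vertices_eq)
  have "inj_on ((`) cls) (flags (dilate \<pi> L) L)"
    by (rule inj_on_subset[OF inj_on_image_Pow[OF inj_on_cls[OF L(1)]]]) (auto simp: flags_iff)
  then have "card {C. chamber C \<and> t \<in> C} = flag_number m"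
    using card_flags[OF layer_lattice[OF L(1)]] chambers_through[OF L(1)] L(2) by (simp add: card_image)
  moreover have "flag_number 1 = 1" using one_less_q by (simp add: flag_number_def)
  ultimately show ?thesis by (simp add: r_def)
qed

section \<open>Close vertices\<close>

text \<open>
  The flags of a line in a hyperplane of the residue space \<open>L / \<pi> L\<close>.
\<close>

definition gates :: "'v set \<Rightarrow> ('v set \<times> 'v set) set" where
  "gates L = {(P, H). layer (dilate \<pi> L) P 1 \<and> P \<subseteq> H \<and> layer H L 1}"

text \<open>
  The modules that can take the place of \<open>\<pi> L\<close> between \<open>\<pi> H\<close> and \<open>P\<close>.
\<close>

definition exchanges :: "'v set \<Rightarrow> 'v set \<Rightarrow> 'v set \<Rightarrow> 'v set set" where
  "exchanges L P H = {M. layer (dilate \<pi> H) M 1 \<and> M \<subseteq> P \<and> M \<noteq> dilate \<pi> L}"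

text \<open>
  The last two facts concern the chain \<open>\<pi> H \<subset> \<pi> L \<subset> P \<subseteq> H\<close>, which is what remains visible when the base
  vertex is moved from \<open>[L]\<close> to \<open>[H]\<close>.
\<close>

lemma gate_between:
  assumes L: "is_lattice L" and m: "3 \<le> m" and g: "(P, H) \<in> gates L"
  shows "dilate \<pi> L \<subset> P" "P \<subseteq> H" "H \<subset> L" "is_lattice P" "is_lattice H"
    "layer P H (m - 2)" "layer (dilate \<pi> H) P 2" "layer (dilate \<pi> H) (dilate \<pi> L) 1"
proof -
  have P: "layer (dilate \<pi> L) P 1" and H: "layer H L 1" and PH: "P \<subseteq> H"
    using g by (auto simp: gates_def)
  note PD = layerD[OF P] and HD = layerD[OF H]
  have PL: "P \<subseteq> L" using PH HD(3) by (rule order_trans)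
  have \<pi>LH: "dilate \<pi> L \<subseteq> H" using PD(3) PH by (rule order_trans)
  show "P \<subseteq> H" by fact
  show "dilate \<pi> L \<subset> P" using layer_psubset[OF P] by simp
  show HL: "H \<subset> L" using layer_psubset[OF H] by simp
  show "is_lattice P" by (rule lattice_between[OF L PD(2,3) PL])
  show Hlat: "is_lattice H" by (rule lattice_between[OF L HD(1) \<pi>LH HD(3)])
  obtain d where d: "m = Suc d" "layer P L d" using layer_above_cover[OF layer_lattice[OF L] P PL] .
  obtain e where e: "e \<le> d" "layer P H e" "layer H L (d - e)" using layer_split[OF d(2) HD(1) PH HD(3)] .
  have "d - e = 1" using layer_unique[OF e(3) H] .
  then have "e = m - 2" using d(1) by simp
  then show "layer P H (m - 2)" using e(2) by simp
  show \<pi>H: "layer (dilate \<pi> H) (dilate \<pi> L) 1" by (rule layer_dilate[OF H uniformizer(1)])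
  note \<pi>HD = layerD[OF \<pi>H]
  obtain f where f: "layer (dilate \<pi> H) P f"
    using layer_split[OF layer_lattice[OF Hlat] PD(2) order_trans[OF \<pi>HD(3) PD(3)] PH] by blast
  obtain g where g: "f = Suc g" "layer (dilate \<pi> L) P g" using layer_above_cover[OF f \<pi>H PD(3)] .
  have "g = 1" using layer_unique[OF g(2) P] .
  then show "layer (dilate \<pi> H) P 2" using f g(1) by (simp add: numeral_2_eq_2)
qed

lemma exchange_in_interval:
  assumes L: "is_lattice L" and m: "3 \<le> m" and g: "(P, H) \<in> gates L" and M: "M \<in> exchanges L P H"
  shows "M \<in> interval (dilate \<pi> H) H" "M \<subset> P" "layer M P 1" "\<not> M \<subseteq> dilate \<pi> L" "\<not> dilate \<pi> L \<subseteq> M"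
proof -
  note G = gate_between[OF L m g]
  have M1: "layer (dilate \<pi> H) M 1" "M \<subseteq> P" "M \<noteq> dilate \<pi> L" using M by (auto simp: exchanges_def)
  note MD = layerD[OF M1(1)]
  have \<pi>HM: "dilate \<pi> H \<subset> M" using layer_psubset[OF M1(1)] by simp
  show "M \<in> interval (dilate \<pi> H) H"
    unfolding interval_def using MD(2) \<pi>HM order_trans[OF M1(2) G(2)] by simp
  have "M \<noteq> P" using layer_unique[OF G(7), of 1] M1(1) by auto
  then show MP: "M \<subset> P" using M1(2) by simp
  show "layer M P 1" by (rule layer_2_between(2)[OF G(7) MD(2) \<pi>HM MP])
  show "\<not> M \<subseteq> dilate \<pi> L" using layer_1_between[OF G(8) MD(2,3)] \<pi>HM M1(3) by blast
  show "\<not> dilate \<pi> L \<subseteq> M"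
    using layer_1_between[OF M1(1) layerD(2,3)[OF G(8)]] layer_psubset[OF G(8)] M1(3) by auto
qed

text \<open>
  Choose a flag of \<open>H / P\<close>.  Together with \<open>L\<close> it gives a complete flag based at \<open>L\<close>, and together with \<open>M\<close>
  one based at \<open>H\<close>; the two chambers differ in one vertex only.
\<close>

lemma closeI_exchange:
  assumes L: "is_lattice L" and m: "3 \<le> m" and g: "(P, H) \<in> gates L" and M: "M \<in> exchanges L P H"
  shows "close (cls L) (cls M)"
proof -
  note G = gate_between[OF L m g] and ME = exchange_in_interval[OF L m g M]
  have P: "layer (dilate \<pi> L) P 1" and H: "layer H L 1"
    using g by (auto simp: gates_def)
  have M1: "layer (dilate \<pi> H) M 1" using M by (auto simp: exchanges_def)
  note PD = layerD[OF P] and HD = layerD[OF H] and MD = layerD[OF M1]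
  have "card (flags P H) \<noteq> 0" using card_flags[OF G(6)] flag_number_pos[of "m - 2"] by simp
  then obtain E where E: "E \<in> flags P H" by (metis card.empty ex_in_conv)
  have EP: "{P} \<union> E \<in> flags (dilate \<pi> L) H"
    using flags_layer_1[OF P] by (intro flag_concat[OF PD(2,3) G(2) _ E]) simp
  define D where "D = {P} \<union> E"
  have DX: "P \<subseteq> X" "X \<subseteq> H" if "X \<in> D" for X
    using that flagD(2,3)[OF E, of X] G(2) by (auto simp: D_def)
  have DL: "D \<union> {L} \<in> flags (dilate \<pi> L) L"
    using flags_layer_1[OF H] EP order_trans[OF PD(3) G(2)] unfolding D_def
    by (intro flag_concat[OF HD(1) _ HD(3)]) simp_all
  have DM: "{M} \<union> D \<in> flags (dilate \<pi> H) H"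
  proof -
    have "{P} \<union> E \<in> flags M H"
      using flags_layer_1[OF ME(3)] by (intro flag_concat[OF PD(2) psubset_imp_subset[OF ME(2)] G(2) _ E]) simp
    then show ?thesis
      using flags_layer_1[OF M1] order_trans[OF psubset_imp_subset[OF ME(2)] G(2)] unfolding D_def
      by (intro flag_concat[OF MD(2,3)]) simp_all
  qed
  have C: "cls ` (D \<union> {L}) \<in> (`) cls ` flags (dilate \<pi> L) L"
    "cls ` ({M} \<union> D) \<in> (`) cls ` flags (dilate \<pi> H) H"
    and sub: "D \<union> {L} \<subseteq> interval (dilate \<pi> L) L" "{M} \<union> D \<subseteq> interval (dilate \<pi> H) H"
    using imageI[OF DL, of "(`) cls"] imageI[OF DM, of "(`) cls"] DL DM by (simp_all only: flags_iff)
  define F where "F = cls ` D"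
  have ch: "chamber (insert (cls L) F)" "chamber (insert (cls M) F)"
    using C unfolding chambers_through[OF L, symmetric] chambers_through[OF G(5), symmetric]
    by (simp_all add: F_def)
  have "L \<notin> D" using DX(2) G(3) by auto
  then have LF: "cls L \<notin> F"
    using inj_on_image_mem_iff[OF inj_on_cls[OF L] top_in_interval[OF L]] sub(1) by (simp add: F_def)
  have "M \<notin> D" using DX(1) ME(2) by auto
  then have MF: "cls M \<notin> F"
    using inj_on_image_mem_iff[OF inj_on_cls[OF G(5)] ME(1)] sub(2) by (simp add: F_def)
  \<comment> \<open>Relative to \<open>H\<close> the vertex \<open>[L]\<close> is represented by \<open>\<pi> L\<close>, and so it differs from \<open>[M]\<close>.\<close>
  have "dilate \<pi> L \<in> interval (dilate \<pi> H) H"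
    using G(3) dilate_psubset_iff[OF uniformizer(1)] layerD(2)[OF G(8)] order_trans[OF PD(3) G(2)]
    by (simp add: interval_def)
  then have "cls (dilate \<pi> L) \<noteq> cls M"
    using inj_onD[OF inj_on_cls[OF G(5)] _ _ ME(1)] ME(4) by blast
  then have LM: "cls L \<noteq> cls M" using cls_dilate[OF L uniformizer(1)] by simp
  have "finite F" using ch(1) by (simp add: chamber_def simplex_def)
  then have "adjacent (insert (cls L) F) (insert (cls M) F)"
    unfolding adjacent_def using ch LF MF by (intro conjI exI[of _ F]) auto
  then show ?thesis
    unfolding close_def using LF MF LM by (intro exI[of _ "insert (cls L) F"] exI[of _ "insert (cls M) F"]) auto
qed

text \<open>
  The gate \<open>(P, H)\<close> is read off from the chamber containing \<open>[L]\<close>.  The new vertex is incident to \<open>[H]\<close>,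
  and its representative \<open>M\<close> between \<open>\<pi> H\<close> and \<open>H\<close> is comparable to all remaining members.  If \<open>M\<close> were not
  below \<open>P\<close>, it would lie above \<open>\<pi> L\<close> and could be added to the first chamber.
\<close>

lemma close_imp_exchange:
  assumes L: "is_lattice L" and m: "3 \<le> m" and cl: "close (cls L) t"
  obtains P H M where "(P, H) \<in> gates L" "M \<in> exchanges L P H" "t = cls M"
proof -
  obtain C C' F where CC: "chamber C" "chamber C'" "F \<subseteq> C" "F \<subseteq> C'" "card C = card F + 1" "card C' = card F + 1"
    "cls L \<in> C" "t \<in> C'" "cls L \<notin> C \<inter> C'" "t \<notin> C \<inter> C'"
    using cl by (auto simp: close_def adjacent_def)
  have tF: "t \<notin> F" "cls L \<notin> F" "t \<noteq> cls L" using CC by auto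
  have finC: "finite C" using CC(1) by (simp add: chamber_def simplex_def)
  have C: "insert (cls L) F = C"
    using CC(3,5,7) tF(2) finC finite_subset[OF CC(3) finC] by (intro card_subset_eq) auto
  have "C \<in> {C. chamber C \<and> cls L \<in> C}" using CC by simp
  then obtain D where D: "D \<in> flags (dilate \<pi> L) L" "C = cls ` D"
    unfolding chambers_through[OF L] by blast
  have DI: "D \<subseteq> interval (dilate \<pi> L) L" using D(1) by (simp add: flags_iff)
  have LD: "L \<in> D" by (rule top_in_flag[OF D(1) lattice_submodule[OF L] dilate_uniformizer_psubset[OF L]])
  have F: "F = cls ` (D - {L})"
  proof -
    have "F = C - {cls L}" using C tF(2) by auto
    then show ?thesis
      using inj_on_image_set_diff[OF inj_on_cls[OF L], of D "{L}"] DI LD D(2) by auto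
  qed
  note lL = layer_lattice[OF L]
  obtain P where P: "P \<in> insert (dilate \<pi> L) D" "layer (dilate \<pi> L) P 1"
    using flag_has_rank[OF lL _ D(1), of 1] m by auto
  obtain H where H: "H \<in> insert (dilate \<pi> L) D" "layer (dilate \<pi> L) H (m - 1)"
    using flag_has_rank[OF lL _ D(1), of "m - 1"] by auto
  have "P \<noteq> dilate \<pi> L" "H \<noteq> dilate \<pi> L"
    using layer_psubset[OF P(2)] layer_psubset[OF H(2)] m by force+
  then have PHD: "P \<in> D" "H \<in> D" using P(1) H(1) by auto
  note PD = layerD[OF P(2)] and HD = layerD[OF H(2)]
  have HL: "H \<subseteq> L" using flagD(3)[OF D(1) PHD(2)] .
  have "P \<noteq> H" using layer_unique[OF P(2), of "m - 1"] H(2) m by auto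
  then have PH: "P \<subseteq> H"
    using flag_comparable[OF D(1) PHD] layer_1_between[OF P(2) HD(2,3)] \<open>H \<noteq> dilate \<pi> L\<close> by auto
  obtain e where e: "e \<le> m" "layer (dilate \<pi> L) H e" "layer H L (m - e)"
    using layer_split[OF lL HD(2,3) HL] .
  have "e = m - 1" using layer_unique[OF e(2) H(2)] .
  then have H1: "layer H L 1" using e(3) m by (simp add: Suc_leD)
  have g: "(P, H) \<in> gates L" using P(2) PH H1 by (simp add: gates_def)
  note G = gate_between[OF L m g]
  have below: "X \<subseteq> H" if X: "X \<in> D - {L}" for X
    using flag_comparable[OF D(1), of X H] layer_1_between[OF H1, of X] flagD(1,3)[OF D(1), of X] X PHD(2) by auto
  have DH: "X \<in> interval (dilate \<pi> H) H" if X: "X \<in> D - {L}" for X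
    using below[OF X] flagD(1,2)[OF D(1), of X] X order_le_less_trans[OF layerD(3)[OF G(8)]]
    by (simp add: interval_def)
  have HF: "H \<in> D - {L}" using PHD(2) G(3) by auto
  have C': "simplex C'" using CC(2) by (simp add: chamber_def)
  then have inc: "incident s t" if "s \<in> F" for s
    using that CC(4,8) tF(1) by (auto simp: simplex_def pairwise_def)
  have "t \<in> vertices" using C' CC(8) by (auto simp: simplex_def)
  moreover have "incident (cls H) t" using inc[of "cls H"] HF F by blast
  ultimately obtain M where M: "M \<in> interval (dilate \<pi> H) H" "t = cls M"
    using normalized_representative[OF G(5)] by blast
  have cmp: "X \<subseteq> M \<or> M \<subseteq> X" if X: "X \<in> D - {L}" for X
    using incident_interval_iff[OF G(5) DH[OF X] M(1)] inc[of "cls X"] X F M(2) by auto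
  have MD: "M \<notin> D - {L}" using tF(1) M(2) F by auto
  have MI: "submodule M" "dilate \<pi> H \<subset> M" "M \<subseteq> H" using M(1) by (auto simp: interval_def)
  have MP: "M \<subset> P"
  proof (rule ccontr)
    assume n: "\<not> M \<subset> P"
    \<comment> \<open>In this case \<open>P \<subseteq> M\<close>, and \<open>M\<close> is comparable to all members of the first flag.\<close>
    have PDL: "P \<in> D - {L}" using PHD(1) PH G(3) by auto
    then have "P \<subseteq> M" using cmp[OF PDL] n MD by auto
    then have "dilate \<pi> L \<subset> M" using G(1) by (rule order_less_le_trans[rotated])
    moreover have MsubL: "M \<subset> L" using MI(3) G(3) by (rule order_le_less_trans)
    moreover have "\<forall>X\<in>D. X \<subseteq> M \<or> M \<subseteq> X" using cmp MsubL by (metis insert_Diff insert_iff LD psubset_imp_subset)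
    ultimately have "M \<in> D" using flag_maximal[OF D(1) MI(1)] by (simp add: psubset_imp_subset)
    then show False using MD MsubL by auto
  qed
  have "M \<noteq> dilate \<pi> L" using M(2) tF(3) cls_dilate[OF L uniformizer(1)] by auto
  then have "M \<in> exchanges L P H"
    using layer_2_between(1)[OF G(7) MI(1,2) MP] MP by (simp add: exchanges_def)
  then show thesis using that g M(2) by blast
qed

text \<open>
  The module \<open>M\<close> is not contained in \<open>\<pi> L\<close>, but \<open>\<pi> M\<close> is; this fixes \<open>M\<close> inside its class.
  Then \<open>P\<close> is the join and \<open>\<pi> H\<close> is the meet of \<open>M\<close> and \<open>\<pi> L\<close>.
\<close>

lemma exchange_inj:
  assumes L: "is_lattice L" and m: "3 \<le> m"
    and g: "(P, H) \<in> gates L" "M \<in> exchanges L P H"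
    and g': "(P', H') \<in> gates L" "M' \<in> exchanges L P' H'"
    and eq: "cls M = cls M'"
  shows "P = P' \<and> H = H' \<and> M = M'"
proof -
  note G = gate_between[OF L m g(1)] and ME = exchange_in_interval[OF L m g]
  note G' = gate_between[OF L m g'(1)] and ME' = exchange_in_interval[OF L m g']
  have sM: "submodule M" "submodule M'" "M \<subseteq> P" "M' \<subseteq> P'"
    using ME(1,2) ME'(1,2) by (auto simp: interval_def)
  have \<pi>: "dilate \<pi> M \<subseteq> dilate \<pi> L" "dilate \<pi> M' \<subseteq> dilate \<pi> L"
    unfolding dilate_subset_iff[OF uniformizer(1)] using sM G(2,3) G'(2,3) by auto
  obtain \<alpha> where \<alpha>: "\<alpha> \<noteq> 0" "M' = dilate \<alpha> M"
    using cls_eqD[OF lattice_interval[OF G'(5) ME'(1)] eq[symmetric]] .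
  \<comment> \<open>Otherwise one of \<open>M\<close> and \<open>M'\<close> lies in \<open>\<pi>\<close> times the other, hence in \<open>\<pi> L\<close>.\<close>
  have MM: "M = M'"
  proof (cases rule: dilate_trichotomy[OF sM(1) \<alpha>(1)])
    case 1
    then have "M' \<subseteq> dilate \<pi> L" using \<alpha>(2) \<pi>(1) by (metis order_trans)
    then show ?thesis using ME'(4) by blast
  next
    case 2
    then show ?thesis using \<alpha>(2) by simp
  next
    case 3
    then have "M \<subseteq> dilate \<pi> M'" using \<alpha>(2) sM(2) by blast
    then have "M \<subseteq> dilate \<pi> L" using \<pi>(2) by (rule order_trans)
    then show ?thesis using ME(4) by blast
  qed
  have P1: "layer (dilate \<pi> L) P 1" "layer (dilate \<pi> L) P' 1" using g(1) g'(1) by (auto simp: gates_def)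
  have I: "submodule (P \<inter> P')" "dilate \<pi> L \<subseteq> P \<inter> P'" "M \<subseteq> P \<inter> P'"
    using layerD(2,3)[OF P1(1)] layerD(2,3)[OF P1(2)] submodule_Int sM MM by auto
  have "P \<inter> P' \<noteq> dilate \<pi> L" using I(3) ME(4) by auto
  then have "P \<inter> P' = P" "P \<inter> P' = P'"
    using layer_1_between[OF P1(1) I(1,2)] layer_1_between[OF P1(2) I(1,2)] by auto
  then have PP: "P = P'" by simp
  have meet: "dilate \<pi> L \<inter> X = dilate \<pi> K"
    if "layer (dilate \<pi> K) (dilate \<pi> L) 1" "X \<in> interval (dilate \<pi> K) K" "\<not> dilate \<pi> L \<subseteq> X" for K X
  proof -
    have "submodule X" "dilate \<pi> K \<subseteq> X" using that(2) by (auto simp: interval_def)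
    then have "submodule (dilate \<pi> L \<inter> X)" "dilate \<pi> K \<subseteq> dilate \<pi> L \<inter> X"
      using layerD(2,3)[OF that(1)] submodule_Int by auto
    then show ?thesis using layer_1_between[OF that(1)] that(3) by blast
  qed
  have "dilate \<pi> H = dilate \<pi> H'"
    using meet[OF G(8) ME(1,5)] meet[OF G'(8) ME'(1,5)] MM by simp
  then show ?thesis using MM PP dilate_eq_iff[OF uniformizer(1)] by simp
qed

text \<open>
  A plane over the residue field has \<open>q + 1\<close> lines, one of which is \<open>\<pi> L\<close>.
\<close>

lemma card_exchanges:
  assumes L: "is_lattice L" and m: "3 \<le> m" and g: "(P, H) \<in> gates L"
  shows "card (exchanges L P H) = q"
proof -
  note G = gate_between[OF L m g]
  let ?C = "{M. layer (dilate \<pi> H) M 1 \<and> M \<subseteq> P}"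
  have "card ?C * (q - 1) = q ^ 2 - 1" by (rule card_covers[OF G(7)])
  also have "\<dots> = (q + 1) * (q - 1)"
    by (simp add: algebra_simps power2_eq_square diff_mult_distrib2)
  finally have "card ?C * (q - 1) = (q + 1) * (q - 1)" .
  moreover have "q - 1 \<noteq> 0" using one_less_q by simp
  ultimately have "card ?C = q + 1" using mult_right_cancel by blast
  moreover have "exchanges L P H = ?C - {dilate \<pi> L}" by (auto simp: exchanges_def)
  moreover have "dilate \<pi> L \<in> ?C" using G(1,8) by simp
  ultimately show ?thesis by simp
qed

lemma finite_gates:
  assumes L: "is_lattice L" shows "finite (gates L)"
proof (rule finite_subset)
  let ?B = "{M. submodule M \<and> dilate \<pi> L \<subseteq> M \<and> M \<subseteq> L}"
  show "finite (?B \<times> ?B)" using finite_between[OF layer_lattice[OF L]] by simp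
  show "gates L \<subseteq> ?B \<times> ?B"
  proof (clarsimp simp only: gates_def mem_Collect_eq mem_Sigma_iff)
    fix P H assume *: "layer (dilate \<pi> L) P 1" "P \<subseteq> H" "layer H L 1"
    show "(submodule P \<and> dilate \<pi> L \<subseteq> P \<and> P \<subseteq> L) \<and> (submodule H \<and> dilate \<pi> L \<subseteq> H \<and> H \<subseteq> L)"
      using layerD(2,3)[OF *(1)] layerD(1,3)[OF *(3)] *(2) by (meson order_trans)
  qed
qed

lemma card_close:
  assumes L: "is_lattice L" and m: "3 \<le> m"
  shows "\<omega> (cls L) = card (gates L) * q"
proof -
  let ?S = "SIGMA g:gates L. exchanges L (fst g) (snd g)"
  have "{t. close (cls L) t} = (\<lambda>(g, M). cls M) ` ?S"
  proof (intro subset_antisym subsetI)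
    fix t assume "t \<in> {t. close (cls L) t}"
    then obtain P H M where "(P, H) \<in> gates L" "M \<in> exchanges L P H" "t = cls M"
      using close_imp_exchange[OF L m] by blast
    then show "t \<in> (\<lambda>(g, M). cls M) ` ?S" by (intro image_eqI[of _ _ "((P, H), M)"]) auto
  next
    fix t assume "t \<in> (\<lambda>(g, M). cls M) ` ?S"
    then show "t \<in> {t. close (cls L) t}" using closeI_exchange[OF L m] by auto
  qed
  moreover have "inj_on (\<lambda>(g, M). cls M) ?S"
    using exchange_inj[OF L m] by (intro inj_onI) (auto, blast+)
  ultimately have "\<omega> (cls L) = card ?S" by (simp add: \<omega>_def card_image)
  also have "\<dots> = (\<Sum>g\<in>gates L. card (exchanges L (fst g) (snd g)))"
  proof (rule card_SigmaI[OF finite_gates[OF L]], rule ballI)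
    fix g assume "g \<in> gates L"
    then have "card (exchanges L (fst g) (snd g)) > 0"
      using card_exchanges[OF L m, of "fst g" "snd g"] one_less_q by simp
    then show "finite (exchanges L (fst g) (snd g))" by (rule card_ge_0_finite)
  qed
  also have "\<dots> = (\<Sum>g\<in>gates L. q)"
    using card_exchanges[OF L m] by (intro sum.cong) auto
  finally show ?thesis by simp
qed

text \<open>
  Split each flag at its first member \<open>P\<close>, and the rest at its member \<open>H\<close> of dimension \<open>m - 2\<close> over \<open>P\<close>.  The
  steps from \<open>\<pi> L\<close> to \<open>P\<close> and from \<open>H\<close> to \<open>L\<close> are covers, each with a single flag.
\<close>

lemma flag_number_eq_gates:
  assumes L: "is_lattice L" and m: "3 \<le> m"
  shows "flag_number m = card (gates L) * flag_number (m - 2)"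
proof -
  let ?A = "{P. layer (dilate \<pi> L) P 1 \<and> P \<subseteq> L}"
  let ?B = "\<lambda>P. {H. layer P H (m - 2) \<and> H \<subseteq> L}"
  note l = layer_lattice[OF L]
  have above: "layer P L (m - 1)" if "P \<in> ?A" for P
    using layer_above_cover[OF l, of P] that by (metis (no_types, lifting) diff_Suc_1 mem_Collect_eq)
  have top: "layer P H (m - 2) \<and> H \<subseteq> L \<longleftrightarrow> P \<subseteq> H \<and> layer H L 1" if P: "P \<in> ?A" for P H
  proof
    assume "layer P H (m - 2) \<and> H \<subseteq> L"
    then have H: "layer P H (m - 2)" "H \<subseteq> L" by auto
    obtain e where "layer P H e" "layer H L (m - 1 - e)"
      using layer_split[OF above[OF P] layerD(2,3)[OF H(1)] H(2)] .
    moreover have "e = m - 2" using layer_unique[OF calculation(1) H(1)] .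
    moreover have "m - 1 - (m - 2) = 1" using m by simp
    ultimately show "P \<subseteq> H \<and> layer H L 1" using layerD(3)[OF H(1)] by simp
  next
    assume "P \<subseteq> H \<and> layer H L 1"
    then have "(P, H) \<in> gates L" "layer H L 1" using P by (auto simp: gates_def)
    then show "layer P H (m - 2) \<and> H \<subseteq> L" using gate_between(6)[OF L m] layerD(3) by blast
  qed
  have "flag_number m = (\<Sum>P\<in>?A. card (flags (dilate \<pi> L) P) * card (flags P L))"
    using card_flags[OF l] card_flags_split[OF l, of 1] m by simp
  also have "\<dots> = (\<Sum>P\<in>?A. card (?B P) * flag_number (m - 2))"
  proof (rule sum.cong[OF refl])
    fix P assume P: "P \<in> ?A"
    have "card (flags P L) = (\<Sum>H\<in>?B P. card (flags P H) * card (flags H L))"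
      by (rule card_flags_split[OF above[OF P]]) simp
    also have "\<dots> = (\<Sum>H\<in>?B P. flag_number (m - 2))"
    proof (rule sum.cong[OF refl])
      fix H assume H: "H \<in> ?B P"
      then have "layer H L 1" using top[OF P] by blast
      then show "card (flags P H) * card (flags H L) = flag_number (m - 2)"
        using H card_flags[of P H "m - 2"] by (simp add: flags_layer_1)
    qed
    finally show "card (flags (dilate \<pi> L) P) * card (flags P L) = card (?B P) * flag_number (m - 2)"
      using P flags_layer_1[of "dilate \<pi> L" P] by simp
  qed
  also have "\<dots> = (\<Sum>P\<in>?A. card (?B P)) * flag_number (m - 2)" by (simp add: sum_distrib_right)
  also have "(\<Sum>P\<in>?A. card (?B P)) = card (SIGMA P:?A. ?B P)"
  proof (rule card_SigmaI[symmetric])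
    show "finite ?A" by (rule finite_subset[OF _ finite_between[OF l]]) (blast dest: layerD(2,3))
    show "\<forall>P\<in>?A. finite (?B P)"
    proof
      fix P assume P: "P \<in> ?A"
      show "finite (?B P)"
        by (rule finite_subset[OF _ finite_between[OF above[OF P]]]) (blast dest: layerD(2,3))
    qed
  qed
  also have "(SIGMA P:?A. ?B P) = gates L"
  proof -
    have "layer (dilate \<pi> L) P 1 \<Longrightarrow> P \<subseteq> H \<Longrightarrow> layer H L 1 \<Longrightarrow> P \<subseteq> L" for P H
      using layerD(3)[of H L 1] by (meson order_trans)
    then have "P \<in> ?A \<and> H \<in> ?B P \<longleftrightarrow> (P, H) \<in> gates L" for P H
      unfolding gates_def using top[of P H] by simp blast
    then show ?thesis by auto
  qed
  finally show ?thesis .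
qed

end

section \<open>The numerical identity\<close>

theorem theorem1p1:
  fixes ord :: "'k::field \<Rightarrow> int"
    and \<pi> :: 'k
    and scaleV :: "'k \<Rightarrow> 'v::ab_group_add \<Rightarrow> 'v"
    and scaleW :: "'k \<Rightarrow> 'w::ab_group_add \<Rightarrow> 'w"
    and V :: "'v set"
    and W :: "'w set"
    and n :: nat
  assumes "3 \<le> n"
    and "local_field ord \<pi>"
    and "building ord \<pi> scaleV V n"
    and "building ord \<pi> scaleW W (n - 2)"
    and "t \<in> building.vertices ord scaleV V n"
    and "t' \<in> building.vertices ord scaleV V n"
    and "s \<in> building.vertices ord scaleW W (n - 2)"
  shows "local_field.q ord * building.r ord \<pi> scaleV V n t =
         building.r ord \<pi> scaleW W (n - 2) s * building.\<omega> ord \<pi> scaleV V n t'"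
proof -
  interpret A: building ord \<pi> scaleV V n by fact
  interpret B: building ord \<pi> scaleW W "n - 2" by fact
  obtain L where L: "A.is_lattice L" "t' = A.cls L" using assms(6) by (auto simp: A.vertices_eq)
  show ?thesis
    using A.card_chambers_through[OF assms(5)] B.card_chambers_through[OF assms(7)]
      A.card_close[OF L(1) assms(1)] A.flag_number_eq_gates[OF L(1) assms(1)] L(2)
    by simp
qed

end
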